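(* Let $G=(V,E)$ be an infinite, locally finite weighted graph with symmetric weight $\omega$, and let $\mu>0$ be a real number. The following are equivalent: (1) (Ultracontractivity) there is a constant $c_1>0$ such that for all $t>0$ and all $f\in\ell^2$, $$\|P_tf\|_\infty\le c_1t^{-\frac\mu4}\|f\|_2 ;$$ (2) (Nash inequality) there is a constant $c_2>0$ such that for every finitely supported $f:V\to[0,\infty)$, $$\|f\|_2^{2+\frac4\mu}\le c_2\,\langle\Gamma(f)\rangle\,\|f\|_1^{\frac4\mu} .$$
   Context: $G=(V,E)$ is an infinite graph with a symmetric weight function $\omega:V\times V\to[0,\infty)$, $\omega_{xy}=\omega_{yx}$; $x\sim y$ iff $\omega_{xy}>0$; loops are allowed. $G$ is locally finite: each vertex has finitely many neighbours. The degree $m(x)=\sum_{y\sim x}\omega_{xy}$ satisfies $0<m(x)<\infty$. Norms: $\|f\|_p=\big(\sum_xm(x)|f(x)|^p\big)^{1/p}$ for $1\le p<\infty$, $\|f\|_\infty=\sup_x|f(x)|$; $\ell^p$ is the corresponding space. $\langle f\rangle=\sum_{x\in V}m(x)f(x)$. Gradient form: $\Gamma(f)(x)=\frac1{2m(x)}\sum_{y\sim x}\omega_{xy}(f(y)-f(x))^2$. Laplacian: $\Delta f(x)=\frac1{m(x)}\sum_{y\sim x}\omega_{xy}(f(y)-f(x))$, bounded and self-adjoint on $\ell^2$. $P_t=e^{t\Delta}$ is the heat semigroup. *)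

theory Defs
  imports "HOL-Analysis.Analysis"
begin

text \<open>
  The vertex set is the type \<open>'v\<close>; the edge relation \<open>x \<sim> y\<close> is \<open>0 < \<omega> x y\<close>, and loops
  (\<open>0 < \<omega> x x\<close>) are allowed.  Functions on vertices are real-valued.
\<close>

definition nbrs :: "('v \<Rightarrow> 'v \<Rightarrow> real) \<Rightarrow> 'v \<Rightarrow> 'v set" where
  "nbrs \<omega> x = {y. 0 < \<omega> x y}"

definition deg :: "('v \<Rightarrow> 'v \<Rightarrow> real) \<Rightarrow> 'v \<Rightarrow> real" where
  "deg \<omega> x = (\<Sum>y\<in>nbrs \<omega> x. \<omega> x y)"

locale weighted_graph =
  fixes \<omega> :: "'v \<Rightarrow> 'v \<Rightarrow> real"
  assumes infinite_vertices: "infinite (UNIV :: 'v set)"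
    and weight_nonneg: "0 \<le> \<omega> x y"
    and weight_sym: "\<omega> x y = \<omega> y x"
    and locally_finite: "finite (nbrs \<omega> x)"
    and deg_pos: "0 < deg \<omega> x"

definition lp :: "('v \<Rightarrow> 'v \<Rightarrow> real) \<Rightarrow> real \<Rightarrow> ('v \<Rightarrow> real) set" where
  "lp \<omega> p = {f. (\<lambda>x. deg \<omega> x * \<bar>f x\<bar> powr p) summable_on UNIV}"

text \<open>For \<open>1 \<le> p < \<infinity>\<close>; only meaningful on \<open>lp \<omega> p\<close>, since \<open>infsum\<close> is \<open>0\<close> when not summable.\<close>

definition lp_norm :: "('v \<Rightarrow> 'v \<Rightarrow> real) \<Rightarrow> real \<Rightarrow> ('v \<Rightarrow> real) \<Rightarrow> real" where
  "lp_norm \<omega> p f = (\<Sum>\<^sub>\<infinity>x. deg \<omega> x * \<bar>f x\<bar> powr p) powr (1 / p)"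

text \<open>Extended-valued, so that it is \<open>\<infinity>\<close> for unbounded \<open>f\<close>
  (\<open>\<ell>\<^sup>2\<close>-functions need not be bounded if \<open>inf deg = 0\<close>).\<close>

definition sup_norm :: "('v \<Rightarrow> real) \<Rightarrow> ereal" where
  "sup_norm f = (SUP x. ereal \<bar>f x\<bar>)"

definition graph_sum :: "('v \<Rightarrow> 'v \<Rightarrow> real) \<Rightarrow> ('v \<Rightarrow> real) \<Rightarrow> real" where
  "graph_sum \<omega> f = (\<Sum>\<^sub>\<infinity>x. deg \<omega> x * f x)"

definition grad_form :: "('v \<Rightarrow> 'v \<Rightarrow> real) \<Rightarrow> ('v \<Rightarrow> real) \<Rightarrow> 'v \<Rightarrow> real" where
  "grad_form \<omega> f x = 1 / (2 * deg \<omega> x) * (\<Sum>y\<in>nbrs \<omega> x. \<omega> x y * (f y - f x)\<^sup>2)"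

definition laplacian :: "('v \<Rightarrow> 'v \<Rightarrow> real) \<Rightarrow> ('v \<Rightarrow> real) \<Rightarrow> 'v \<Rightarrow> real" where
  "laplacian \<omega> f x = 1 / deg \<omega> x * (\<Sum>y\<in>nbrs \<omega> x. \<omega> x y * (f y - f x))"

text \<open>
  The exponential \<open>e\<^bsup>t\<Delta>\<^esup> = \<Sum>n. t\<^sup>n / n! \<Delta>\<^sup>n\<close> of the bounded operator \<open>\<Delta>\<close> on \<open>\<ell>\<^sup>2\<close>, evaluated at
  a vertex.  The lemmas \<open>heat_lp2\<close> and \<open>heat_operator_norm_limit\<close> below show that on \<open>\<ell>\<^sup>2\<close> this is
  the sum of the exponential series in the operator norm.
\<close>

definition heat :: "('v \<Rightarrow> 'v \<Rightarrow> real) \<Rightarrow> real \<Rightarrow> ('v \<Rightarrow> real) \<Rightarrow> 'v \<Rightarrow> real" where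
  "heat \<omega> t f x = (\<Sum>n. t ^ n / fact n * (laplacian \<omega> ^^ n) f x)"


context weighted_graph
begin

abbreviation wL2 :: "'v set \<Rightarrow> ('v \<Rightarrow> real) \<Rightarrow> real" where
  "wL2 F f \<equiv> L2_set (\<lambda>x. sqrt (deg \<omega> x) * f x) F"

lemma wL2_eq: "wL2 F f = sqrt (\<Sum>x\<in>F. deg \<omega> x * (f x)\<^sup>2)"
  by (simp add: L2_set_def power_mult_distrib less_imp_le[OF deg_pos])

lemma powr2: "\<bar>a::real\<bar> powr 2 = a\<^sup>2"
  by (cases "a = 0") auto

lemma lp2_iff: "f \<in> lp \<omega> 2 \<longleftrightarrow> (\<lambda>x. deg \<omega> x * (f x)\<^sup>2) summable_on UNIV"
  by (simp add: lp_def powr2)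

lemma deg_sq_nonneg: "0 \<le> deg \<omega> x * (f x)\<^sup>2"
  using deg_pos[of x] by simp

lemma lp_norm2: "lp_norm \<omega> 2 f = sqrt (\<Sum>\<^sub>\<infinity>x. deg \<omega> x * (f x)\<^sup>2)"
  by (simp add: lp_norm_def powr2 powr_half_sqrt infsum_nonneg deg_sq_nonneg)

lemma lp_norm2_nonneg: "0 \<le> lp_norm \<omega> 2 f"
  by (simp add: lp_norm_def)

lemma wL2_le_norm:
  assumes "f \<in> lp \<omega> 2" "finite F"
  shows "wL2 F f \<le> lp_norm \<omega> 2 f"
  unfolding wL2_eq lp_norm2
  using assms by (intro real_sqrt_le_mono finite_sum_le_infsum) (auto simp: lp2_iff deg_sq_nonneg)

lemma lp2_bounded:
  assumes "\<And>F. finite F \<Longrightarrow> wL2 F f \<le> C"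
  shows "f \<in> lp \<omega> 2" "lp_norm \<omega> 2 f \<le> C"
proof -
  have C: "0 \<le> C" using assms[of "{}"] by simp
  have b: "(\<Sum>x\<in>F. deg \<omega> x * (f x)\<^sup>2) \<le> C\<^sup>2" if "finite F" for F
    using assms[OF that] C unfolding wL2_eq by (simp add: sqrt_le_D)
  have s: "(\<lambda>x. deg \<omega> x * (f x)\<^sup>2) summable_on UNIV"
    by (rule nonneg_bdd_above_summable_on) (auto simp: deg_sq_nonneg intro!: bdd_aboveI2 b)
  then show "f \<in> lp \<omega> 2" by (simp add: lp2_iff)
  have "(\<Sum>\<^sub>\<infinity>x. deg \<omega> x * (f x)\<^sup>2) \<le> C\<^sup>2"
    by (rule infsum_le_finite_sums[OF s]) (rule b)
  then show "lp_norm \<omega> 2 f \<le> C"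
    unfolding lp_norm2 using C by (simp add: real_le_lsqrt infsum_nonneg deg_sq_nonneg)
qed

lemma laplacian_local:
  "deg \<omega> x * (laplacian \<omega> f x)\<^sup>2 \<le> 2 * (\<Sum>y\<in>nbrs \<omega> x. \<omega> x y * (f y)\<^sup>2) + 2 * (deg \<omega> x * (f x)\<^sup>2)"
proof -
  let ?N = "nbrs \<omega> x" and ?d = "deg \<omega> x"
  have d: "0 < ?d" by (rule deg_pos)
  have "(\<Sum>y\<in>?N. \<omega> x y * (f y - f x))\<^sup>2
      = (\<Sum>y\<in>?N. sqrt (\<omega> x y) * (sqrt (\<omega> x y) * (f y - f x)))\<^sup>2"
    by (simp add: weight_nonneg flip: mult.assoc)
  also have "\<dots> \<le> (\<Sum>y\<in>?N. (sqrt (\<omega> x y))\<^sup>2) * (\<Sum>y\<in>?N. (sqrt (\<omega> x y) * (f y - f x))\<^sup>2)"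
    by (rule Cauchy_Schwarz_ineq_sum)
  also have "\<dots> = ?d * (\<Sum>y\<in>?N. \<omega> x y * (f y - f x)\<^sup>2)"
    by (simp add: deg_def weight_nonneg power_mult_distrib)
  finally have cs: "(\<Sum>y\<in>?N. \<omega> x y * (f y - f x))\<^sup>2 \<le> ?d * (\<Sum>y\<in>?N. \<omega> x y * (f y - f x)\<^sup>2)" .
  have "?d * (laplacian \<omega> f x)\<^sup>2 = (\<Sum>y\<in>?N. \<omega> x y * (f y - f x))\<^sup>2 / ?d"
    using d by (simp add: laplacian_def power_divide power2_eq_square)
  also have "\<dots> \<le> (\<Sum>y\<in>?N. \<omega> x y * (f y - f x)\<^sup>2)"
    using cs d by (simp add: field_simps)
  also have "\<dots> \<le> (\<Sum>y\<in>?N. \<omega> x y * (2 * (f y)\<^sup>2 + 2 * (f x)\<^sup>2))"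
  proof (intro sum_mono mult_left_mono weight_nonneg)
    fix y
    have "0 \<le> (f y + f x)\<^sup>2" by simp
    then show "(f y - f x)\<^sup>2 \<le> 2 * (f y)\<^sup>2 + 2 * (f x)\<^sup>2"
      by (simp add: power2_eq_square algebra_simps)
  qed
  also have "\<dots> = 2 * (\<Sum>y\<in>?N. \<omega> x y * (f y)\<^sup>2) + 2 * (?d * (f x)\<^sup>2)"
    by (simp add: deg_def sum.distrib sum_distrib_left sum_distrib_right algebra_simps)
  finally show ?thesis .
qed

lemma laplacian_lp2:
  assumes f: "f \<in> lp \<omega> 2"
  shows "laplacian \<omega> f \<in> lp \<omega> 2" "lp_norm \<omega> 2 (laplacian \<omega> f) \<le> 2 * lp_norm \<omega> 2 f"
proof -
  let ?S = "\<Sum>\<^sub>\<infinity>x. deg \<omega> x * (f x)\<^sup>2"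
  have le: "(\<Sum>x\<in>F. deg \<omega> x * (f x)\<^sup>2) \<le> ?S" if "finite F" for F
    using f that by (intro finite_sum_le_infsum) (auto simp: lp2_iff deg_sq_nonneg)
  have b: "wL2 F (laplacian \<omega> f) \<le> 2 * lp_norm \<omega> 2 f" if F: "finite F" for F
  proof -
    define U where "U = (\<Union>x\<in>F. nbrs \<omega> x)"
    have U: "finite U" using F locally_finite by (simp add: U_def)
    have "(\<Sum>x\<in>F. \<Sum>y\<in>nbrs \<omega> x. \<omega> x y * (f y)\<^sup>2) \<le> (\<Sum>x\<in>F. \<Sum>y\<in>U. \<omega> x y * (f y)\<^sup>2)"
      using U by (intro sum_mono sum_mono2) (auto simp: U_def weight_nonneg)
    also have "\<dots> = (\<Sum>y\<in>U. (\<Sum>x\<in>F. \<omega> y x) * (f y)\<^sup>2)"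
      by (subst sum.swap) (simp add: sum_distrib_right weight_sym)
    also have "\<dots> \<le> (\<Sum>y\<in>U. deg \<omega> y * (f y)\<^sup>2)"
    proof (intro sum_mono mult_right_mono)
      fix y
      have "(\<Sum>x\<in>F. \<omega> y x) = (\<Sum>x\<in>F \<inter> nbrs \<omega> y. \<omega> y x)"
        using F weight_nonneg[of y]
        by (intro sum.mono_neutral_right) (auto simp: nbrs_def not_less intro: antisym)
      also have "\<dots> \<le> deg \<omega> y"
        unfolding deg_def by (intro sum_mono2) (auto simp: locally_finite weight_nonneg)
      finally show "(\<Sum>x\<in>F. \<omega> y x) \<le> deg \<omega> y" .
    qed simp
    also have "\<dots> \<le> ?S" by (rule le[OF U])
    finally have n: "(\<Sum>x\<in>F. \<Sum>y\<in>nbrs \<omega> x. \<omega> x y * (f y)\<^sup>2) \<le> ?S" .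
    have "(\<Sum>x\<in>F. deg \<omega> x * (laplacian \<omega> f x)\<^sup>2)
        \<le> (\<Sum>x\<in>F. 2 * (\<Sum>y\<in>nbrs \<omega> x. \<omega> x y * (f y)\<^sup>2) + 2 * (deg \<omega> x * (f x)\<^sup>2))"
      by (intro sum_mono laplacian_local)
    also have "\<dots> = 2 * (\<Sum>x\<in>F. \<Sum>y\<in>nbrs \<omega> x. \<omega> x y * (f y)\<^sup>2) + 2 * (\<Sum>x\<in>F. deg \<omega> x * (f x)\<^sup>2)"
      by (simp add: sum.distrib sum_distrib_left)
    also have "\<dots> \<le> 4 * ?S" using n le[OF F] by linarith
    finally have "wL2 F (laplacian \<omega> f) \<le> sqrt (4 * ?S)"
      unfolding wL2_eq by simp
    then show ?thesis by (simp add: lp_norm2 real_sqrt_mult)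
  qed
  show "laplacian \<omega> f \<in> lp \<omega> 2" "lp_norm \<omega> 2 (laplacian \<omega> f) \<le> 2 * lp_norm \<omega> 2 f"
    using lp2_bounded[OF b] by auto
qed

lemma laplacian_power_lp2:
  assumes f: "f \<in> lp \<omega> 2"
  shows "(laplacian \<omega> ^^ n) f \<in> lp \<omega> 2 \<and> lp_norm \<omega> 2 ((laplacian \<omega> ^^ n) f) \<le> 2 ^ n * lp_norm \<omega> 2 f"
proof (induction n)
  case (Suc n)
  then show ?case using laplacian_lp2[of "(laplacian \<omega> ^^ n) f"] by fastforce
qed (use f in auto)

lemma wL2_laplacian_power:
  assumes "f \<in> lp \<omega> 2" "finite F"
  shows "wL2 F ((laplacian \<omega> ^^ n) f) \<le> 2 ^ n * lp_norm \<omega> 2 f"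
  using laplacian_power_lp2[OF assms(1), of n] wL2_le_norm[OF _ assms(2)] by (meson order_trans)

lemma wL2_term:
  assumes "f \<in> lp \<omega> 2" "finite F"
  shows "wL2 F (\<lambda>x. t ^ n / fact n * (laplacian \<omega> ^^ n) f x) \<le> (2 * \<bar>t\<bar>) ^ n / fact n * lp_norm \<omega> 2 f"
proof -
  have "wL2 F (\<lambda>x. t ^ n / fact n * (laplacian \<omega> ^^ n) f x)
      = wL2 F (\<lambda>x. \<bar>t ^ n / fact n\<bar> * (laplacian \<omega> ^^ n) f x)"
    unfolding wL2_eq by (simp add: power_mult_distrib power_divide flip: power_abs)
  also have "\<dots> = \<bar>t ^ n / fact n\<bar> * wL2 F ((laplacian \<omega> ^^ n) f)"
    by (subst L2_set_right_distrib) (auto simp: mult_ac)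
  also have "\<dots> \<le> \<bar>t ^ n / fact n\<bar> * (2 ^ n * lp_norm \<omega> 2 f)"
    by (intro mult_left_mono wL2_laplacian_power assms) auto
  also have "\<dots> = (2 * \<bar>t\<bar>) ^ n / fact n * lp_norm \<omega> 2 f"
    by (simp add: power_mult_distrib power_abs)
  finally show ?thesis .
qed

lemma exp_terms: "(\<lambda>n. a ^ n / fact n) sums exp (a::real)"
  using exp_converges[of a] by (simp add: divide_inverse mult.commute)

lemma heat_summable:
  assumes f: "f \<in> lp \<omega> 2"
  shows "summable (\<lambda>n. t ^ n / fact n * (laplacian \<omega> ^^ n) f x)"
proof (rule summable_comparison_test')
  show "summable (\<lambda>n. (2 * \<bar>t\<bar>) ^ n / fact n * (lp_norm \<omega> 2 f / sqrt (deg \<omega> x)))"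
    using exp_terms[THEN sums_summable] by (rule summable_mult2)
  fix n
  let ?a = "t ^ n / fact n * (laplacian \<omega> ^^ n) f x"
  have s: "0 < sqrt (deg \<omega> x)" using deg_pos by simp
  have "sqrt (deg \<omega> x) * \<bar>?a\<bar> \<le> (2 * \<bar>t\<bar>) ^ n / fact n * lp_norm \<omega> 2 f"
    using wL2_term[OF f, of "{x}" t n] s by (simp add: L2_set_def abs_mult)
  then show "norm ?a \<le> (2 * \<bar>t\<bar>) ^ n / fact n * (lp_norm \<omega> 2 f / sqrt (deg \<omega> x))"
    using s by (simp add: field_simps)
qed

lemma wL2_sum_le: "finite I \<Longrightarrow> wL2 F (\<lambda>x. \<Sum>i\<in>I. g i x) \<le> (\<Sum>i\<in>I. wL2 F (g i))"
proof (induction I rule: finite_induct)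
  case (insert i I)
  have "wL2 F (\<lambda>x. \<Sum>j\<in>insert i I. g j x)
      = L2_set (\<lambda>x. sqrt (deg \<omega> x) * g i x + sqrt (deg \<omega> x) * (\<Sum>j\<in>I. g j x)) F"
    using insert by (simp add: distrib_left)
  also have "\<dots> \<le> wL2 F (g i) + wL2 F (\<lambda>x. \<Sum>j\<in>I. g j x)"
    by (rule L2_set_triangle_ineq)
  finally show ?case using insert by simp
qed (simp add: L2_set_def)

lemma heat_tail:
  assumes f: "f \<in> lp \<omega> 2" and F: "finite F"
  shows "wL2 F (\<lambda>x. heat \<omega> t f x - (\<Sum>n<N. t ^ n / fact n * (laplacian \<omega> ^^ n) f x))
    \<le> (exp (2 * \<bar>t\<bar>) - (\<Sum>n<N. (2 * \<bar>t\<bar>) ^ n / fact n)) * lp_norm \<omega> 2 f"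
proof -
  let ?h = "\<lambda>n x. t ^ n / fact n * (laplacian \<omega> ^^ n) f x"
  let ?e = "\<lambda>n. (2 * \<bar>t\<bar>) ^ n / fact n :: real"
  let ?E = "exp (2 * \<bar>t\<bar>) - (\<Sum>n<N. ?e n)"
  have lim: "(\<lambda>M. wL2 F (\<lambda>x. \<Sum>n<M. ?h (n + N) x)) \<longlonglongrightarrow> wL2 F (\<lambda>x. heat \<omega> t f x - (\<Sum>n<N. ?h n x))"
    unfolding wL2_eq
  proof (intro tendsto_intros)
    fix x
    have "(\<lambda>n. ?h n x) sums heat \<omega> t f x"
      unfolding heat_def using heat_summable[OF f] by (rule summable_sums)
    then have "(\<lambda>n. ?h (n + N) x) sums (heat \<omega> t f x - (\<Sum>n<N. ?h n x))"
      by (subst sums_iff_shift) simp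
    then show "(\<lambda>M. \<Sum>n<M. ?h (n + N) x) \<longlonglongrightarrow> heat \<omega> t f x - (\<Sum>n<N. ?h n x)"
      by (simp add: sums_def)
  qed
  have es: "(\<lambda>n. ?e (n + N)) sums ?E"
    using exp_terms[of "2 * \<bar>t\<bar>"] by (subst sums_iff_shift) simp
  have "wL2 F (\<lambda>x. \<Sum>n<M. ?h (n + N) x) \<le> ?E * lp_norm \<omega> 2 f" for M
  proof -
    have "wL2 F (\<lambda>x. \<Sum>n<M. ?h (n + N) x) \<le> (\<Sum>n<M. wL2 F (?h (n + N)))"
      by (rule wL2_sum_le) simp
    also have "\<dots> \<le> (\<Sum>n<M. ?e (n + N) * lp_norm \<omega> 2 f)"
      by (intro sum_mono wL2_term f F)
    also have "\<dots> = (\<Sum>n<M. ?e (n + N)) * lp_norm \<omega> 2 f"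
      by (simp add: sum_distrib_right)
    also have "(\<Sum>n<M. ?e (n + N)) \<le> ?E"
      using sum_le_suminf[OF sums_summable[OF es], of "{..<M}"] sums_unique[OF es] by simp
    finally show ?thesis by (simp add: mult_right_mono lp_norm2_nonneg)
  qed
  then show ?thesis
    by (intro LIMSEQ_le_const2[OF lim]) blast
qed

lemma heat_lp2: "f \<in> lp \<omega> 2 \<Longrightarrow> heat \<omega> t f \<in> lp \<omega> 2"
  by (rule lp2_bounded(1)[OF heat_tail[of f _ t 0, simplified]])

lemma heat_operator_norm_limit:
  "\<exists>\<epsilon>. \<epsilon> \<longlonglongrightarrow> 0 \<and> (\<forall>N. \<forall>f\<in>lp \<omega> 2.
     lp_norm \<omega> 2 (\<lambda>x. heat \<omega> t f x - (\<Sum>n<N. t ^ n / fact n * (laplacian \<omega> ^^ n) f x))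
       \<le> \<epsilon> N * lp_norm \<omega> 2 f)"
proof (intro exI conjI allI ballI)
  let ?\<epsilon> = "\<lambda>N. exp (2 * \<bar>t\<bar>) - (\<Sum>n<N. (2 * \<bar>t\<bar>) ^ n / fact n)"
  show "?\<epsilon> \<longlonglongrightarrow> 0"
    using tendsto_diff[OF tendsto_const exp_terms[of "2 * \<bar>t\<bar>", unfolded sums_def], of "exp (2 * \<bar>t\<bar>)"]
    by simp
  fix N f assume "f \<in> lp \<omega> 2"
  then show "lp_norm \<omega> 2 (\<lambda>x. heat \<omega> t f x - (\<Sum>n<N. t ^ n / fact n * (laplacian \<omega> ^^ n) f x))
      \<le> ?\<epsilon> N * lp_norm \<omega> 2 f"
    by (intro lp2_bounded(2) heat_tail)
qed

end

end

theory Submission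
  imports Defs
begin

text \<open>
  Self-adjointness of \<open>P\<^sub>t\<close> and the semigroup law give \<open>\<parallel>P\<^sub>t f\<parallel>\<^sub>2\<^sup>2 = \<langle>P\<^sub>2\<^sub>t f, f\<rangle>\<close>; this is differentiable in
  \<open>t\<close> with derivative \<open>- 2 \<langle>\<Gamma>(P\<^sub>t f)\<rangle>\<close>, and it is convex.

  If \<open>P\<^sub>t\<close> is ultracontractive, then by duality \<open>\<parallel>P\<^sub>t f\<parallel>\<^sub>2 \<le> c t powr (- \<mu>/4) \<parallel>f\<parallel>\<^sub>1\<close>, and convexity yields
  \<open>\<parallel>f\<parallel>\<^sub>2\<^sup>2 \<le> \<parallel>P\<^sub>t f\<parallel>\<^sub>2\<^sup>2 + 2 t \<langle>\<Gamma>(f)\<rangle>\<close>; balancing the two terms in \<open>t\<close> gives Nash's inequality.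

  Conversely, Nash's inequality for \<open>P\<^sub>t \<delta>\<^sub>z\<close>, which is nonnegative of mass at most that of \<open>\<delta>\<^sub>z\<close>, is a
  differential inequality for \<open>\<parallel>P\<^sub>t \<delta>\<^sub>z\<parallel>\<^sub>2\<^sup>2\<close> forcing it to decay like \<open>t powr (- \<mu>/2)\<close>; since
  \<open>deg z * P\<^sub>t g z = \<langle>g, P\<^sub>t \<delta>\<^sub>z\<rangle>\<close>, the bound for \<open>P\<^sub>t g\<close> follows by the Cauchy-Schwarz inequality.
\<close>

section \<open>Real-variable tools: exponential series, optimisation in time, decay\<close>

text \<open>The scalar core of the semigroup law, meant for the moments
  \<open>a j = ip ((laplacian \<omega> ^^ j) f) g\<close>. The geometric bound makes the double
  series over (n, k) absolutely summable; summing by rows gives \<open>c\<close>, summing along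
  antidiagonals gives the series in s + t by the binomial theorem.\<close>

lemma exp_shifted_series:
  fixes a :: "nat \<Rightarrow> real"
  assumes bound: "\<And>j. \<bar>a j\<bar> \<le> C * K ^ j" and "0 \<le> K"
    and inner: "\<And>n. (\<lambda>k. t ^ k / fact k * a (n + k)) sums b n"
    and outer: "(\<lambda>n. s ^ n / fact n * b n) sums c"
  shows "(\<lambda>j. (s + t) ^ j / fact j * a j) sums c"
proof -
  let ?f = "\<lambda>(n, k). (s ^ n / fact n) * (t ^ k / fact k) * a (n + k)"
  have exps: "summable (\<lambda>n. (\<bar>r\<bar> * K) ^ n / fact n)" for r :: real
    using summable_exp[of "\<bar>r\<bar> * K"] by (simp add: divide_inverse mult.commute)
  have exps_on: "(\<lambda>n. (\<bar>r\<bar> * K) ^ n / fact n) summable_on UNIV" for r :: real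
    using exps \<open>0 \<le> K\<close> by (intro summable_nonneg_imp_summable_on) auto
  have "(\<lambda>(n, k). (C * ((\<bar>s\<bar> * K) ^ n / fact n)) * ((\<bar>t\<bar> * K) ^ k / fact k)) summable_on UNIV \<times> UNIV"
  proof (rule summable_on_SigmaI)
    show "((\<lambda>k. case (n, k) of (n, k) \<Rightarrow> (C * ((\<bar>s\<bar> * K) ^ n / fact n)) * ((\<bar>t\<bar> * K) ^ k / fact k))
      has_sum (C * ((\<bar>s\<bar> * K) ^ n / fact n)) * (\<Sum>\<^sub>\<infinity>k. (\<bar>t\<bar> * K) ^ k / fact k)) UNIV" for n
      by (simp only: prod.case) (intro has_sum_cmult_right has_sum_infsum exps_on)
    show "(\<lambda>n. C * ((\<bar>s\<bar> * K) ^ n / fact n) * (\<Sum>\<^sub>\<infinity>k. (\<bar>t\<bar> * K) ^ k / fact k)) summable_on UNIV"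
      by (intro summable_on_cmult_left summable_on_cmult_right exps_on)
    have "0 \<le> C" using bound[of 0] by simp
    then show "0 \<le> (case (n, k) of (n, k) \<Rightarrow> (C * ((\<bar>s\<bar> * K) ^ n / fact n)) * ((\<bar>t\<bar> * K) ^ k / fact k))" for n k
      using \<open>0 \<le> K\<close> by simp
  qed
  then have abs: "(\<lambda>p. norm (?f p)) summable_on UNIV \<times> UNIV"
  proof (rule summable_on_comparison_test)
    fix p :: "nat \<times> nat" assume "p \<in> UNIV \<times> UNIV"
    obtain n k where p: "p = (n, k)" by force
    have "norm (?f p) = (\<bar>s\<bar> ^ n / fact n) * (\<bar>t\<bar> ^ k / fact k) * \<bar>a (n + k)\<bar>"
      by (simp add: p abs_mult power_abs)
    also have "\<dots> \<le> (\<bar>s\<bar> ^ n / fact n) * (\<bar>t\<bar> ^ k / fact k) * (C * K ^ (n + k))"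
      by (intro mult_left_mono bound) auto
    also have "\<dots> = (C * ((\<bar>s\<bar> * K) ^ n / fact n)) * ((\<bar>t\<bar> * K) ^ k / fact k)"
      by (simp add: power_mult_distrib power_add)
    finally show "norm (?f p) \<le> (case p of (n, k) \<Rightarrow> (C * ((\<bar>s\<bar> * K) ^ n / fact n)) * ((\<bar>t\<bar> * K) ^ k / fact k))"
      by (simp add: p)
  qed auto
  then have "?f summable_on UNIV \<times> UNIV" by (rule abs_summable_summable)
  then obtain S where S: "(?f has_sum S) (UNIV \<times> UNIV)" by (auto simp: summable_on_def)
  \<comment> \<open>\<open>sums\<close> alone yields no unordered sum; absolute summability of a row
    is inherited from the double series.\<close>
  have row: "((\<lambda>k. ?f (n, k)) has_sum s ^ n / fact n * b n) UNIV" for n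
  proof -
    have "(\<lambda>k. norm (?f (n, k))) summable_on UNIV"
      using Infinite_Sum.abs_summable_on_Sigma_iff[THEN iffD1, OF abs] by blast
    then have "summable (\<lambda>k. norm (?f (n, k)))"
      by (rule summable_on_imp_summable)
    moreover have "(\<lambda>k. ?f (n, k)) sums (s ^ n / fact n * b n)"
      using sums_mult[OF inner[of n], of "s ^ n / fact n"] by (simp add: mult_ac)
    ultimately show ?thesis by (rule norm_summable_imp_has_sum)
  qed
  have "((\<lambda>n. s ^ n / fact n * b n) has_sum S) UNIV"
    by (rule has_sum_SigmaD[OF S row])
  then have "S = c"
    using outer has_sum_imp_sums sums_unique2 by blast
  \<comment> \<open>Antidiagonals: j is the total degree n + k, and i \<le> j keeps the subtraction
    j - i from being truncated.\<close>
  have bij: "bij_betw (\<lambda>(j, i). (i, j - i)) (SIGMA j:UNIV. {..j}) (UNIV \<times> (UNIV :: nat set))"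
    by (rule bij_betwI[where g = "\<lambda>(n, k). (n + k, n)"]) auto
  have "((\<lambda>p. ?f (case p of (j, i) \<Rightarrow> (i, j - i))) has_sum c) (SIGMA j:UNIV. {..j})"
    using S \<open>S = c\<close> has_sum_reindex_bij_betw[OF bij, where f = ?f] by simp
  then have "((\<lambda>j. (s + t) ^ j / fact j * a j) has_sum c) UNIV"
  proof (rule has_sum_SigmaD)
    fix j :: nat
    have "(s + t) ^ j / fact j * a j = (\<Sum>i\<le>j. ?f (i, j - i))"
      unfolding binomial_ring sum_divide_distrib sum_distrib_right
      by (intro sum.cong) (auto simp: binomial_fact)
    then show "((\<lambda>i. ?f (case (j, i) of (j, i) \<Rightarrow> (i, j - i))) has_sum (s + t) ^ j / fact j * a j) {..j}"
      by (intro has_sum_finiteI) auto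
  qed
  then show ?thesis by (rule has_sum_imp_sums)
qed

text \<open>The bound holds for every t, so it may be used at the time where its two terms balance;
  \<open>C + 2\<close> then collects the coefficients.\<close>

lemma nash_balance:
  fixes S M E C \<mu> :: real
  assumes "0 < \<mu>" "0 \<le> S" "0 \<le> M" "0 \<le> E" "0 \<le> C"
    and bound: "\<And>t. 0 < t \<Longrightarrow> S \<le> C * t powr (- \<mu> / 2) * M\<^sup>2 + 2 * t * E"
  shows "S powr (1 + 2 / \<mu>) \<le> (C + 2) powr (1 + 2 / \<mu>) * E * M powr (4 / \<mu>)"
proof -
  define a where "a = \<mu> / 2"
  have a: "0 < a" "1 + 2 / \<mu> = 1 + 1 / a" "4 / \<mu> = 2 / a" "- \<mu> / 2 = - a"
    using \<open>0 < \<mu>\<close> by (auto simp: a_def)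
  show ?thesis
  proof (cases "E = 0 \<or> M = 0")
    case True
    \<comment> \<open>No balancing time exists here: for E = 0 let t tend to infinity, for M = 0
      take t = e / (2 * E) with e arbitrarily small.\<close>
    have "S \<le> 0"
    proof (cases "E = 0")
      case True
      have "((\<lambda>t. t powr (- a)) \<longlongrightarrow> 0) at_top"
        using a by (intro tendsto_neg_powr filterlim_ident) auto
      then have "((\<lambda>t. C * t powr (- a) * M\<^sup>2) \<longlongrightarrow> C * 0 * M\<^sup>2) at_top"
        by (intro tendsto_intros)
      moreover have "\<forall>\<^sub>F t in at_top. S \<le> C * t powr (- a) * M\<^sup>2"
        using eventually_gt_at_top[of 0] by eventually_elim (use bound True a in simp)
      ultimately show ?thesis
        by (intro tendsto_lowerbound[of "\<lambda>t. C * t powr (- a) * M\<^sup>2" 0 at_top S]) auto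
    next
      case False
      then have "M = 0" "0 < E" using True \<open>0 \<le> E\<close> by auto
      show ?thesis
      proof (rule field_le_epsilon)
        fix e :: real assume "0 < e"
        then show "S \<le> 0 + e"
          using bound[of "e / (2 * E)"] \<open>M = 0\<close> \<open>0 < E\<close> by simp
      qed
    qed
    then have "S powr (1 + 2 / \<mu>) = 0" using \<open>0 \<le> S\<close> by simp
    also have "0 \<le> (C + 2) powr (1 + 2 / \<mu>) * E * M powr (4 / \<mu>)"
      using \<open>0 \<le> E\<close> by simp
    finally show ?thesis .
  next
    case False
    then have pos: "0 < E" "0 < M" using assms by auto
    \<comment> \<open>The solution of \<open>t powr (- a) * M\<^sup>2 = t * E\<close>.\<close>
    define t where "t = (M\<^sup>2 / E) powr (1 / (1 + a))"
    have t: "0 < t" using pos by (simp add: t_def)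
    have "t powr (1 + a) = M\<^sup>2 / E"
      using a pos by (simp add: t_def powr_powr)
    then have balance: "t powr (- a) * M\<^sup>2 = t * E" and tE: "t powr (1 + a) * E = M\<^sup>2"
      using t pos by (auto simp: powr_add powr_minus field_simps)
    have "S \<le> (C + 2) * (t * E)"
      using bound[OF t] balance unfolding a(4) by (simp add: distrib_right mult.assoc)
    then have "S powr (1 + 1 / a) \<le> ((C + 2) * (t * E)) powr (1 + 1 / a)"
      using assms a by (intro powr_mono2) auto
    also have "\<dots> = (C + 2) powr (1 + 1 / a) * (t * E) powr (1 + 1 / a)"
      using assms t by (simp add: powr_mult)
    \<comment> \<open>As 1 + 1/a = (1 + a)/a, the known power \<open>t powr (1 + a)\<close> appears
      and t is eliminated through \<open>tE\<close>.\<close>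
    also have "(t * E) powr (1 + 1 / a) = (t powr (1 + a) * E powr (1 + a)) powr (1 / a)"
      using a t pos by (simp add: powr_mult powr_powr field_simps)
    also have "\<dots> = (M\<^sup>2 * E powr a) powr (1 / a)"
      unfolding tE[symmetric] by (simp only: powr_add powr_one_gt_zero_iff mult_ac) (use pos in \<open>simp add: mult_ac\<close>)
    also have "\<dots> = M powr (2 / a) * E"
      using a pos by (simp add: powr_mult powr_powr flip: powr_numeral)
    finally show ?thesis by (simp add: a mult_ac)
  qed
qed

text \<open>The differential inequality says that \<open>N powr (- 1 / a)\<close> grows at least linearly.\<close>

lemma nash_decay:
  fixes N N' :: "real \<Rightarrow> real"
  assumes "0 < a" "0 < K" "0 < t"
    and nonneg: "\<And>s. 0 \<le> N s"
    and deriv: "\<And>s. (N has_real_derivative N' s) (at s)"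
    and decay: "\<And>s. 0 \<le> s \<Longrightarrow> N' s \<le> - K * N s powr (1 + 1 / a)"
  shows "N t \<le> (K / a * t) powr (- a)"
proof (cases "N t = 0")
  case False
  \<comment> \<open>N is nonincreasing from time 0 on, so N t \<noteq> 0 keeps N positive on [0, t],
    where its negative power is then differentiable.\<close>
  have pos: "0 < N s" if "0 \<le> s" "s \<le> t" for s
  proof -
    have "N t \<le> N s"
    proof (rule DERIV_nonpos_imp_nonincreasing[OF that(2)])
      fix r assume "s \<le> r"
      have "N' r \<le> - K * N r powr (1 + 1 / a)" using decay \<open>s \<le> r\<close> that by simp
      also have "\<dots> \<le> 0" using \<open>0 < K\<close> by simp
      finally show "\<exists>y. DERIV N r :> y \<and> y \<le> 0" using deriv by blast
    qed
    then show ?thesis using False nonneg[of t] by linarith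
  qed
  let ?G = "\<lambda>s. N s powr (- 1 / a) - K / a * s"
  have "?G 0 \<le> ?G t"
  proof (rule DERIV_nonneg_imp_nondecreasing[of 0 t ?G])
    fix s assume s: "0 \<le> s" "s \<le> t"
    let ?d = "- 1 / a * N s powr (- 1 / a - 1) * N' s - K / a"
    have "(?G has_real_derivative ?d) (at s)"
      using pos[OF s] \<open>0 < a\<close> by (auto intro!: derivative_eq_intros deriv simp: field_simps)
    moreover have "0 \<le> ?d"
    proof -
      have "K = K * (N s powr (1 + 1 / a) * N s powr (- 1 / a - 1))"
        using pos[OF s] by (simp flip: powr_add)
      also have "\<dots> \<le> - N' s * N s powr (- 1 / a - 1)"
        using mult_right_mono[OF decay[OF s(1)], of "N s powr (- 1 / a - 1)"] by simp
      finally show ?thesis using \<open>0 < a\<close> by (simp add: field_simps)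
    qed
    ultimately show "\<exists>y. (?G has_real_derivative y) (at s) \<and> 0 \<le> y" by blast
  qed (use assms in simp)
  \<comment> \<open>Dropping the nonnegative value at 0 makes the bound independent of
    \<open>N 0\<close>.\<close>
  then have "K / a * t \<le> N t powr (- 1 / a)"
    using powr_ge_zero[of "N 0" "- 1 / a"] unfolding mult_zero_right diff_0_right by linarith
  then have "(N t powr (- 1 / a)) powr (- a) \<le> (K / a * t) powr (- a)"
    using assms by (intro powr_mono2') auto
  then show ?thesis
    using pos[of t] assms by (simp add: powr_powr)
qed (use assms in simp)


text \<open>A finite set of pairs lies in the square of the union of its two projections. Hence sums
  over pairs are limits over squares, the form in which they arise when a function is truncated to a
  finite set.\<close>

lemma finite_squares_exhaust:
  "filterlim (\<lambda>F. F \<times> F) (finite_subsets_at_top (UNIV \<times> UNIV)) (finite_subsets_at_top UNIV)"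
  unfolding filterlim_finite_subsets_at_top
proof (intro allI impI)
  fix X :: "('a \<times> 'a) set" assume "finite X \<and> X \<subseteq> UNIV \<times> UNIV"
  then show "\<forall>\<^sub>F F in finite_subsets_at_top UNIV. finite (F \<times> F) \<and> X \<subseteq> F \<times> F \<and> F \<times> F \<subseteq> UNIV \<times> UNIV"
    unfolding eventually_finite_subsets_at_top
    by (intro exI[of _ "fst ` X \<union> snd ` X"]) force
qed

context weighted_graph
begin

section \<open>The weighted inner product and the bilinear form of the weights\<close>

definition ip :: "('v \<Rightarrow> real) \<Rightarrow> ('v \<Rightarrow> real) \<Rightarrow> real" where
  "ip f g = (\<Sum>\<^sub>\<infinity>x. deg \<omega> x * f x * g x)"

text \<open>On \<ell>2 this is the form of \<Delta> + 1. Summing over all ordered pairs is harmless,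
  since non-neighbours have weight 0, and makes symmetry a swap of coordinates.\<close>

definition pair_form :: "('v \<Rightarrow> real) \<Rightarrow> ('v \<Rightarrow> real) \<Rightarrow> real" where
  "pair_form f g = (\<Sum>\<^sub>\<infinity>(x, y)\<in>UNIV \<times> UNIV. \<omega> x y * f x * g y)"

abbreviation energy :: "('v \<Rightarrow> real) \<Rightarrow> real" where
  "energy f \<equiv> graph_sum \<omega> (grad_form \<omega> f)"

lemma ip_summable:
  assumes "f \<in> lp \<omega> 2" "g \<in> lp \<omega> 2"
  shows "(\<lambda>x. norm (deg \<omega> x * f x * g x)) summable_on UNIV"
proof -
  have sq: "(\<lambda>x. norm ((sqrt (deg \<omega> x) * h x) * (sqrt (deg \<omega> x) * h x))) summable_on UNIV"
    if "h \<in> lp \<omega> 2" for h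
  proof -
    have "norm ((sqrt (deg \<omega> x) * h x) * (sqrt (deg \<omega> x) * h x)) = deg \<omega> x * (h x)\<^sup>2" for x
      using deg_pos[of x] by (simp add: power_mult_distrib flip: power2_eq_square)
    then have "(\<lambda>x. norm ((sqrt (deg \<omega> x) * h x) * (sqrt (deg \<omega> x) * h x))) = (\<lambda>x. deg \<omega> x * (h x)\<^sup>2)"
      by blast
    then show ?thesis using that unfolding lp2_iff by (simp only:)
  qed
  have "(sqrt (deg \<omega> x) * f x) * (sqrt (deg \<omega> x) * g x) = deg \<omega> x * f x * g x" for x
    using deg_pos[of x] by (simp add: mult_ac flip: mult.assoc[of "sqrt _"])
  then show ?thesis
    using abs_summable_product[OF sq sq, of f g] assms by (simp only:)
qed

lemma ip_has_sum:
  "f \<in> lp \<omega> 2 \<Longrightarrow> g \<in> lp \<omega> 2 \<Longrightarrow> ((\<lambda>x. deg \<omega> x * f x * g x) has_sum ip f g) UNIV"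
  unfolding ip_def by (rule has_sum_infsum[OF abs_summable_summable[OF ip_summable]])

lemma ip_commute: "ip f g = ip g f"
  by (simp add: ip_def mult_ac)

lemma lp_norm2_sq: "(lp_norm \<omega> 2 f)\<^sup>2 = ip f f"
proof -
  have "0 \<le> (\<Sum>\<^sub>\<infinity>x. deg \<omega> x * (f x)\<^sup>2)" by (intro infsum_nonneg deg_sq_nonneg)
  then show ?thesis by (simp add: lp_norm2 ip_def power2_eq_square mult.assoc)
qed

lemma ip_self_nonneg: "0 \<le> ip f f"
  by (simp flip: lp_norm2_sq)

lemma ip_Cauchy_Schwarz:
  assumes "f \<in> lp \<omega> 2" "g \<in> lp \<omega> 2"
  shows "\<bar>ip f g\<bar> \<le> lp_norm \<omega> 2 f * lp_norm \<omega> 2 g"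
proof -
  have "\<bar>ip f g\<bar> \<le> (\<Sum>\<^sub>\<infinity>x. \<bar>deg \<omega> x * f x * g x\<bar>)"
    using norm_infsum_bound[OF ip_summable[OF assms]] by (simp add: ip_def)
  also have "\<dots> \<le> lp_norm \<omega> 2 f * lp_norm \<omega> 2 g"
  proof (rule infsum_le_finite_sums)
    show "(\<lambda>x. \<bar>deg \<omega> x * f x * g x\<bar>) summable_on UNIV"
      using ip_summable[OF assms] by simp
    fix F :: "'v set" assume F: "finite F"
    have "(\<Sum>x\<in>F. \<bar>deg \<omega> x * f x * g x\<bar>)
        = (\<Sum>x\<in>F. \<bar>sqrt (deg \<omega> x) * f x\<bar> * \<bar>sqrt (deg \<omega> x) * g x\<bar>)"
    proof (rule sum.cong)
      fix x
      have "deg \<omega> x * f x * g x = (sqrt (deg \<omega> x) * f x) * (sqrt (deg \<omega> x) * g x)"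
        using deg_pos[of x] by simp
      then show "\<bar>deg \<omega> x * f x * g x\<bar> = \<bar>sqrt (deg \<omega> x) * f x\<bar> * \<bar>sqrt (deg \<omega> x) * g x\<bar>"
        by (simp only: abs_mult)
    qed simp
    also have "\<dots> \<le> wL2 F f * wL2 F g" by (rule L2_set_mult_ineq)
    also have "\<dots> \<le> lp_norm \<omega> 2 f * lp_norm \<omega> 2 g"
      by (intro mult_mono wL2_le_norm assms F L2_set_nonneg lp_norm2_nonneg)
    finally show "(\<Sum>x\<in>F. \<bar>deg \<omega> x * f x * g x\<bar>) \<le> lp_norm \<omega> 2 f * lp_norm \<omega> 2 g" .
  qed
  finally show ?thesis .
qed

lemma nbrs_has_sum: "((\<lambda>y. \<omega> x y * h y) has_sum (\<Sum>y\<in>nbrs \<omega> x. \<omega> x y * h y)) UNIV"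
proof (rule has_sum_finite_neutralI)
  show "\<omega> x y * h y = 0" if "y \<in> UNIV - nbrs \<omega> x" for y
    using that weight_nonneg[of x y] by (auto simp: nbrs_def)
qed (auto simp: locally_finite)

text \<open>Swapping coordinates preserves the weights because they are symmetric; self-adjointness
  of \<Delta> rests on this.\<close>

lemma pair_has_sum_swap:
  assumes "((\<lambda>(x, y). \<omega> x y * h x y) has_sum S) (UNIV \<times> UNIV)"
  shows "((\<lambda>(x, y). \<omega> x y * h y x) has_sum S) (UNIV \<times> UNIV)"
proof -
  have "(\<lambda>(x, y). case (y, x) of (x, y) \<Rightarrow> \<omega> x y * h x y) = (\<lambda>(x, y). \<omega> x y * h y x)"
  proof
    fix p :: "'v \<times> 'v"
    show "(case p of (x, y) \<Rightarrow> case (y, x) of (x, y) \<Rightarrow> \<omega> x y * h x y) = (case p of (x, y) \<Rightarrow> \<omega> x y * h y x)"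
      by (cases p) (simp add: weight_sym)
  qed
  then show ?thesis using has_sum_swap[THEN iffD1, OF assms] by (simp only:)
qed

text \<open>The weights in row x add up to \<open>deg \<omega> x\<close>; all terms are nonnegative,
  so summable row sums give summability over pairs.\<close>

lemma pair_sq_has_sum:
  assumes "f \<in> lp \<omega> 2"
  shows "((\<lambda>(x, y). \<omega> x y * (f x)\<^sup>2) has_sum ip f f) (UNIV \<times> UNIV)"
proof (rule has_sum_SigmaI)
  show row: "((\<lambda>y. case (x, y) of (x, y) \<Rightarrow> \<omega> x y * (f x)\<^sup>2) has_sum deg \<omega> x * f x * f x) UNIV" for x
    using nbrs_has_sum[of x "\<lambda>_. (f x)\<^sup>2"]
    by (simp add: deg_def sum_distrib_right power2_eq_square mult.assoc)
  show "((\<lambda>x. deg \<omega> x * f x * f x) has_sum ip f f) UNIV"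
    by (intro ip_has_sum assms)
  then show "(\<lambda>(x, y). \<omega> x y * (f x)\<^sup>2) summable_on UNIV \<times> UNIV"
    by (intro summable_on_SigmaI[OF row]) (auto simp: weight_nonneg dest: has_sum_imp_summable)
qed

lemma pair_sq_has_sum':
  assumes "f \<in> lp \<omega> 2"
  shows "((\<lambda>(x, y). \<omega> x y * (f y)\<^sup>2) has_sum ip f f) (UNIV \<times> UNIV)"
  using pair_has_sum_swap[of "\<lambda>x y. (f x)\<^sup>2"] pair_sq_has_sum[OF assms] by blast

text \<open>The terms are dominated by
  \<open>\<omega> x y * ((f x)\<^sup>2 + (g y)\<^sup>2)\<close>, whose two parts are summable by the
  previous lemmas.\<close>

lemma pair_form_has_sum:
  assumes "f \<in> lp \<omega> 2" "g \<in> lp \<omega> 2"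
  shows "((\<lambda>(x, y). \<omega> x y * f x * g y) has_sum pair_form f g) (UNIV \<times> UNIV)"
  unfolding pair_form_def
proof (rule has_sum_infsum, rule abs_summable_summable)
  have "(\<lambda>p. (case p of (x, y) \<Rightarrow> \<omega> x y * (f x)\<^sup>2) + (case p of (x, y) \<Rightarrow> \<omega> x y * (g y)\<^sup>2))
    summable_on UNIV \<times> UNIV"
    using pair_sq_has_sum[OF assms(1)] pair_sq_has_sum'[OF assms(2)]
    by (rule summable_on_add[OF has_sum_imp_summable has_sum_imp_summable])
  then show "(\<lambda>p. norm (case p of (x, y) \<Rightarrow> \<omega> x y * f x * g y)) summable_on UNIV \<times> UNIV"
  proof (rule summable_on_comparison_test)
    fix p :: "'v \<times> 'v"
    obtain x y where p: "p = (x, y)" by force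
    have "\<bar>f x * g y\<bar> \<le> (f x)\<^sup>2 + (g y)\<^sup>2"
      using sum_squares_bound[of "\<bar>f x\<bar>" "\<bar>g y\<bar>"] abs_ge_zero[of "f x * g y"]
      by (simp only: abs_mult power2_abs)
    then have "\<omega> x y * \<bar>f x * g y\<bar> \<le> \<omega> x y * ((f x)\<^sup>2 + (g y)\<^sup>2)"
      by (intro mult_left_mono weight_nonneg)
    then show "norm (case p of (x, y) \<Rightarrow> \<omega> x y * f x * g y)
      \<le> (case p of (x, y) \<Rightarrow> \<omega> x y * (f x)\<^sup>2) + (case p of (x, y) \<Rightarrow> \<omega> x y * (g y)\<^sup>2)"
      by (simp add: p abs_mult weight_nonneg algebra_simps)
  qed auto
qed

lemma pair_form_commute:
  assumes "f \<in> lp \<omega> 2" "g \<in> lp \<omega> 2"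
  shows "pair_form f g = pair_form g f"
proof -
  have "((\<lambda>(x, y). \<omega> x y * (f x * g y)) has_sum pair_form g f) (UNIV \<times> UNIV)"
    by (rule pair_has_sum_swap[of "\<lambda>x y. f y * g x"])
      (use pair_form_has_sum[OF assms(2,1)] in \<open>simp add: mult_ac\<close>)
  moreover have "((\<lambda>(x, y). \<omega> x y * (f x * g y)) has_sum pair_form f g) (UNIV \<times> UNIV)"
    using pair_form_has_sum[OF assms] by (simp add: mult.assoc)
  ultimately show ?thesis using has_sum_unique by blast
qed

section \<open>Self-adjointness of the Laplacian and the energy\<close>

lemma deg_laplacian: "deg \<omega> x * laplacian \<omega> f x = (\<Sum>y\<in>nbrs \<omega> x. \<omega> x y * f y) - deg \<omega> x * f x"
proof -
  have "deg \<omega> x * laplacian \<omega> f x = (\<Sum>y\<in>nbrs \<omega> x. \<omega> x y * (f y - f x))"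
    using deg_pos[of x] by (simp add: laplacian_def)
  also have "\<dots> = (\<Sum>y\<in>nbrs \<omega> x. \<omega> x y * f y) - deg \<omega> x * f x"
    unfolding deg_def sum_distrib_right by (simp add: right_diff_distrib sum_subtractf)
  finally show ?thesis .
qed

text \<open>By \<open>deg_laplacian\<close>, row x of \<open>pair_form g f\<close> sums to deg(x)
  (\<Delta>f(x) + f(x)) g(x); summing over x gives the claim up to the symmetry of the form.\<close>

lemma ip_laplacian:
  assumes f: "f \<in> lp \<omega> 2" and g: "g \<in> lp \<omega> 2"
  shows "ip (laplacian \<omega> f) g = pair_form f g - ip f g"
proof -
  have "((\<lambda>x. deg \<omega> x * laplacian \<omega> f x * g x + deg \<omega> x * f x * g x) has_sum pair_form g f) UNIV"
  proof (rule has_sum_SigmaD[OF pair_form_has_sum[OF g f]])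
    fix x
    have "deg \<omega> x * laplacian \<omega> f x * g x + deg \<omega> x * f x * g x = g x * (\<Sum>y\<in>nbrs \<omega> x. \<omega> x y * f y)"
      by (simp add: deg_laplacian algebra_simps)
    then show "((\<lambda>y. case (x, y) of (x, y) \<Rightarrow> \<omega> x y * g x * f y) has_sum
        deg \<omega> x * laplacian \<omega> f x * g x + deg \<omega> x * f x * g x) UNIV"
      using has_sum_cmult_right[OF nbrs_has_sum, of "g x" x f] by (simp add: mult_ac)
  qed
  moreover have "((\<lambda>x. deg \<omega> x * laplacian \<omega> f x * g x + deg \<omega> x * f x * g x)
      has_sum ip (laplacian \<omega> f) g + ip f g) UNIV"
    by (intro has_sum_add ip_has_sum laplacian_lp2 f g)
  ultimately show ?thesis
    using pair_form_commute[OF f g] by (auto dest: has_sum_unique)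
qed

lemma laplacian_selfadjoint:
  assumes "f \<in> lp \<omega> 2" "g \<in> lp \<omega> 2"
  shows "ip (laplacian \<omega> f) g = ip f (laplacian \<omega> g)"
  using ip_laplacian[OF assms] ip_laplacian[OF assms(2,1)] pair_form_commute[OF assms]
    ip_commute[of f g] ip_commute[of f "laplacian \<omega> g"] by linarith

lemma laplacian_power_selfadjoint:
  assumes "f \<in> lp \<omega> 2" "g \<in> lp \<omega> 2"
  shows "ip ((laplacian \<omega> ^^ n) f) g = ip f ((laplacian \<omega> ^^ n) g)"
  using assms
proof (induction n arbitrary: g)
  case (Suc n)
  have "ip ((laplacian \<omega> ^^ Suc n) f) g = ip ((laplacian \<omega> ^^ n) f) (laplacian \<omega> g)"
    using Suc.prems laplacian_power_lp2 by (simp add: laplacian_selfadjoint)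
  also have "\<dots> = ip f ((laplacian \<omega> ^^ n) (laplacian \<omega> g))"
    using Suc.prems by (intro Suc.IH laplacian_lp2)
  finally show ?case by (simp add: funpow_swap1)
qed simp

text \<open>Expand \<open>(f y - f x)\<^sup>2\<close> over all pairs: each square contributes
  \<open>ip f f\<close>, the cross term \<open>- 2 * pair_form f f\<close>, and the factor 1/2 in
  \<open>grad_form\<close> halves the total.\<close>

lemma energy_eq:
  assumes f: "f \<in> lp \<omega> 2"
  shows "energy f = ip f f - pair_form f f"
proof -
  have "((\<lambda>p. (case p of (x, y) \<Rightarrow> \<omega> x y * (f x)\<^sup>2) + (case p of (x, y) \<Rightarrow> \<omega> x y * (f y)\<^sup>2)
      + - 2 * (case p of (x, y) \<Rightarrow> \<omega> x y * f x * f y)) has_sum (ip f f + ip f f + - 2 * pair_form f f)) (UNIV \<times> UNIV)"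
    using pair_sq_has_sum[OF f] pair_sq_has_sum'[OF f] pair_form_has_sum[OF f f]
    by (rule has_sum_add[OF has_sum_add has_sum_cmult_right])
  then have "((\<lambda>x. 2 * (deg \<omega> x * grad_form \<omega> f x)) has_sum (ip f f + ip f f + - 2 * pair_form f f)) UNIV"
  proof (rule has_sum_SigmaD)
    fix x
    have "2 * (deg \<omega> x * grad_form \<omega> f x) = (\<Sum>y\<in>nbrs \<omega> x. \<omega> x y * (f y - f x)\<^sup>2)"
      using deg_pos[of x] by (simp add: grad_form_def)
    then show "((\<lambda>y. (case (x, y) of (x, y) \<Rightarrow> \<omega> x y * (f x)\<^sup>2) + (case (x, y) of (x, y) \<Rightarrow> \<omega> x y * (f y)\<^sup>2)
      + - 2 * (case (x, y) of (x, y) \<Rightarrow> \<omega> x y * f x * f y)) has_sum 2 * (deg \<omega> x * grad_form \<omega> f x)) UNIV"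
      using nbrs_has_sum[of x "\<lambda>y. (f y - f x)\<^sup>2"]
      by (simp add: power2_eq_square algebra_simps)
  qed
  then have "(\<Sum>\<^sub>\<infinity>x. 2 * (deg \<omega> x * grad_form \<omega> f x)) = ip f f + ip f f + - 2 * pair_form f f"
    by (rule infsumI)
  then show ?thesis
    by (simp add: graph_sum_def infsum_cmult_right')
qed

lemma energy_eq_ip_laplacian: "f \<in> lp \<omega> 2 \<Longrightarrow> energy f = - ip (laplacian \<omega> f) f"
  by (simp add: energy_eq ip_laplacian)

lemma energy_nonneg: "0 \<le> energy f"
  unfolding graph_sum_def grad_form_def
  by (intro infsum_nonneg mult_nonneg_nonneg divide_nonneg_nonneg sum_nonneg)
    (auto simp: weight_nonneg less_imp_le[OF deg_pos])

section \<open>The heat semigroup in weak form: series, semigroup law, derivatives\<close>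

text \<open>Linearity of \<open>ip\<close> in the shape that the remainder of the exponential series
  requires.\<close>

lemma ip_diff_sum_has_sum:
  fixes N :: nat
  assumes "u \<in> lp \<omega> 2" "g \<in> lp \<omega> 2" and h: "\<And>n. h n \<in> lp \<omega> 2"
  shows "((\<lambda>x. deg \<omega> x * (u x - (\<Sum>n<N. c n * h n x)) * g x)
    has_sum (ip u g - (\<Sum>n<N. c n * ip (h n) g))) UNIV"
proof (induction N)
  case 0
  show ?case using ip_has_sum assms by simp
next
  case (Suc N)
  have "((\<lambda>x. - c N * (deg \<omega> x * h N x * g x)) has_sum - c N * ip (h N) g) UNIV"
    by (intro has_sum_cmult_right ip_has_sum h assms)
  from has_sum_add[OF Suc.IH this] show ?case
    by (simp add: algebra_simps)
qed

text \<open>Operator-norm convergence of the series and Cauchy-Schwarz. From here on, questions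
  about the semigroup become questions about scalar power series in t.\<close>

lemma heat_ip_sums:
  assumes f: "f \<in> lp \<omega> 2" and g: "g \<in> lp \<omega> 2"
  shows "(\<lambda>n. t ^ n / fact n * ip ((laplacian \<omega> ^^ n) f) g) sums ip (heat \<omega> t f) g"
proof -
  let ?P = "\<lambda>N x. \<Sum>n<N. t ^ n / fact n * (laplacian \<omega> ^^ n) f x"
  let ?S = "\<lambda>N. \<Sum>n<N. t ^ n / fact n * ip ((laplacian \<omega> ^^ n) f) g"
  obtain \<epsilon> where \<epsilon>: "\<epsilon> \<longlonglongrightarrow> 0"
    "\<And>N. lp_norm \<omega> 2 (\<lambda>x. heat \<omega> t f x - ?P N x) \<le> \<epsilon> N * lp_norm \<omega> 2 f"
    using heat_operator_norm_limit[of t] f by blast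
  have "\<bar>ip (heat \<omega> t f) g - ?S N\<bar> \<le> \<epsilon> N * lp_norm \<omega> 2 f * lp_norm \<omega> 2 g" for N
  proof -
    have D: "(\<lambda>x. heat \<omega> t f x - ?P N x) \<in> lp \<omega> 2"
      by (rule lp2_bounded(1)[OF heat_tail[OF f]])
    have "ip (\<lambda>x. heat \<omega> t f x - ?P N x) g = ip (heat \<omega> t f) g - ?S N"
      unfolding ip_def[of "\<lambda>x. heat \<omega> t f x - ?P N x"]
      using laplacian_power_lp2[OF f] by (intro infsumI ip_diff_sum_has_sum heat_lp2 f g) blast
    then have "\<bar>ip (heat \<omega> t f) g - ?S N\<bar> \<le> lp_norm \<omega> 2 (\<lambda>x. heat \<omega> t f x - ?P N x) * lp_norm \<omega> 2 g"
      using ip_Cauchy_Schwarz[OF D g] by (simp only:)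
    also have "\<dots> \<le> \<epsilon> N * lp_norm \<omega> 2 f * lp_norm \<omega> 2 g"
      by (intro mult_right_mono \<epsilon> lp_norm2_nonneg)
    finally show ?thesis .
  qed
  moreover have "(\<lambda>N. \<epsilon> N * lp_norm \<omega> 2 f * lp_norm \<omega> 2 g) \<longlonglongrightarrow> 0"
    using tendsto_mult_left_zero[OF tendsto_mult_left_zero[OF \<epsilon>(1)]] .
  ultimately have "(\<lambda>N. ip (heat \<omega> t f) g - ?S N) \<longlonglongrightarrow> 0"
    by (intro Lim_null_comparison[where f = "\<lambda>N. ip (heat \<omega> t f) g - ?S N"]) auto
  then have "?S \<longlonglongrightarrow> ip (heat \<omega> t f) g"
    using tendsto_diff[OF tendsto_const[of "ip (heat \<omega> t f) g"], of "\<lambda>N. ip (heat \<omega> t f) g - ?S N" 0] by simp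
  then show ?thesis by (simp add: sums_def)
qed

lemma heat_selfadjoint:
  assumes f: "f \<in> lp \<omega> 2" and g: "g \<in> lp \<omega> 2"
  shows "ip (heat \<omega> t f) g = ip f (heat \<omega> t g)"
proof -
  have "(\<lambda>n. t ^ n / fact n * ip ((laplacian \<omega> ^^ n) f) g) sums ip (heat \<omega> t g) f"
    using heat_ip_sums[OF g f] unfolding trans[OF laplacian_power_selfadjoint[OF f g] ip_commute] .
  then have "ip (heat \<omega> t f) g = ip (heat \<omega> t g) f"
    using heat_ip_sums[OF f g] by (rule sums_unique2[symmetric])
  then show ?thesis by (rule trans[OF _ ip_commute])
qed

text \<open>By local finiteness \<Delta> is a finite sum at each vertex, so it can be applied to the
  series term by term.\<close>

lemma laplacian_heat:
  assumes f: "f \<in> lp \<omega> 2"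
  shows "laplacian \<omega> (heat \<omega> t f) = heat \<omega> t (laplacian \<omega> f)"
proof
  fix x
  let ?h = "\<lambda>n y. t ^ n / fact n * (laplacian \<omega> ^^ n) f y"
  have h: "(\<lambda>n. ?h n y) sums heat \<omega> t f y" for y
    unfolding heat_def using heat_summable[OF f] by (rule summable_sums)
  have "(\<lambda>n. 1 / deg \<omega> x * (\<Sum>y\<in>nbrs \<omega> x. \<omega> x y * (?h n y - ?h n x))) sums laplacian \<omega> (heat \<omega> t f) x"
    unfolding laplacian_def[of \<omega> "heat \<omega> t f"] by (intro sums_mult sums_sum sums_diff h)
  moreover have "1 / deg \<omega> x * (\<Sum>y\<in>nbrs \<omega> x. \<omega> x y * (?h n y - ?h n x))
      = t ^ n / fact n * (laplacian \<omega> ^^ n) (laplacian \<omega> f) x" for n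
    unfolding funpow_swap1[symmetric] laplacian_def[of \<omega> "(laplacian \<omega> ^^ n) f"]
    by (simp add: sum_distrib_left right_diff_distrib sum_subtractf mult_ac)
  ultimately show "laplacian \<omega> (heat \<omega> t f) x = heat \<omega> t (laplacian \<omega> f) x"
    by (simp add: heat_def sums_iff)
qed

text \<open>Self-adjointness moves every power of \<Delta> onto f, so both expansions involve only
  the moments \<open>?a j\<close>, which grow at most like 2^j; \<open>exp_shifted_series\<close>
  then applies.\<close>

lemma heat_semigroup:
  assumes f: "f \<in> lp \<omega> 2" and g: "g \<in> lp \<omega> 2"
  shows "ip (heat \<omega> s f) (heat \<omega> t g) = ip (heat \<omega> (s + t) f) g"
proof -
  let ?a = "\<lambda>j. ip ((laplacian \<omega> ^^ j) f) g"
  have "(\<lambda>j. (s + t) ^ j / fact j * ?a j) sums ip (heat \<omega> s f) (heat \<omega> t g)"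
  proof (rule exp_shifted_series)
    fix j
    have "\<bar>?a j\<bar> \<le> lp_norm \<omega> 2 ((laplacian \<omega> ^^ j) f) * lp_norm \<omega> 2 g"
      using laplacian_power_lp2[OF f] g by (blast intro: ip_Cauchy_Schwarz)
    also have "\<dots> \<le> 2 ^ j * lp_norm \<omega> 2 f * lp_norm \<omega> 2 g"
      using laplacian_power_lp2[OF f] by (intro mult_right_mono lp_norm2_nonneg) blast
    finally show "\<bar>?a j\<bar> \<le> lp_norm \<omega> 2 f * lp_norm \<omega> 2 g * 2 ^ j" by (simp add: mult_ac)
  next
    fix n
    let ?u = "(laplacian \<omega> ^^ n) f"
    have u: "?u \<in> lp \<omega> 2" using laplacian_power_lp2[OF f] by blast
    have "ip ((laplacian \<omega> ^^ k) g) ?u = ?a (n + k)" for k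
    proof -
      have "ip ((laplacian \<omega> ^^ k) g) ?u = ip g ((laplacian \<omega> ^^ k) ?u)"
        by (rule laplacian_power_selfadjoint[OF g u])
      also have "\<dots> = ?a (n + k)"
        unfolding add.commute[of n k] funpow_add comp_apply by (rule ip_commute)
      finally show ?thesis .
    qed
    then show "(\<lambda>k. t ^ k / fact k * ?a (n + k)) sums ip ?u (heat \<omega> t g)"
      using heat_ip_sums[OF g u, of t] by (simp add: ip_commute[of ?u])
  qed (use heat_ip_sums[OF f heat_lp2[OF g]] in auto)
  then show ?thesis using heat_ip_sums[OF f g] sums_unique2 by blast
qed

text \<open>The power series converges for every t and may be differentiated termwise; the index
  shift in \<open>diffs\<close> amounts to replacing f by \<Delta>f.\<close>

lemma heat_ip_deriv:
  assumes f: "f \<in> lp \<omega> 2" and g: "g \<in> lp \<omega> 2"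
  shows "((\<lambda>t. ip (heat \<omega> t f) g) has_real_derivative ip (heat \<omega> t (laplacian \<omega> f)) g) (at t)"
proof -
  let ?c = "\<lambda>n. ip ((laplacian \<omega> ^^ n) f) g / fact n"
  have series: "(\<lambda>n. ?c n * r ^ n) sums ip (heat \<omega> r f) g" for r
    using heat_ip_sums[OF f g, of r] by (simp add: mult.commute)
  have "((\<lambda>r. \<Sum>n. ?c n * r ^ n) has_real_derivative (\<Sum>n. diffs ?c n * t ^ n)) (at t)"
    using series by (intro termdiffs_strong_converges_everywhere) (auto simp: sums_iff)
  moreover have "diffs ?c n * t ^ n = t ^ n / fact n * ip ((laplacian \<omega> ^^ n) (laplacian \<omega> f)) g" for n
    by (simp add: diffs_def funpow_swap1 field_simps del: of_nat_Suc)
  ultimately show ?thesis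
    using series heat_ip_sums[OF laplacian_lp2(1)[OF f] g, of t] by (simp add: sums_iff)
qed

lemma heat_0: "heat \<omega> 0 f = f"
proof
  fix x
  \<comment> \<open>As \<open>0 ^ 0 = 1\<close>, exactly the term n = 0 survives.\<close>
  have "(\<lambda>n. 0 ^ n / fact n * (laplacian \<omega> ^^ n) f x) = (\<lambda>n. if n = 0 then f x else 0)"
    by auto
  then show "heat \<omega> 0 f x = f x" unfolding heat_def using sums_unique[OF sums_single[of 0 "\<lambda>_. f x"]] by simp
qed

text \<open>The semigroup law turns a product of two time-dependent factors into the single series
  for \<open>ip (heat \<omega> (2 * t) f) f\<close>, to which the chain rule applies.\<close>

lemma heat_norm_deriv:
  assumes f: "f \<in> lp \<omega> 2"
  shows "((\<lambda>t. ip (heat \<omega> t f) (heat \<omega> t f)) has_real_derivative - 2 * energy (heat \<omega> t f)) (at t)"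
proof -
  have "((\<lambda>t. ip (heat \<omega> (2 * t) f) f) has_real_derivative ip (heat \<omega> (2 * t) (laplacian \<omega> f)) f * 2) (at t)"
    by (rule DERIV_chain2[where f = "\<lambda>t. ip (heat \<omega> t f) f", OF heat_ip_deriv[OF f f] DERIV_cmult_Id])
  moreover have "ip (heat \<omega> (2 * t) (laplacian \<omega> f)) f = - energy (heat \<omega> t f)"
    using heat_semigroup[OF laplacian_lp2(1)[OF f] f, of t t]
    by (simp add: energy_eq_ip_laplacian heat_lp2 laplacian_heat f)
  moreover have "ip (heat \<omega> t f) (heat \<omega> t f) = ip (heat \<omega> (2 * t) f) f" for t
    using heat_semigroup[OF f f, of t t] by simp
  ultimately show ?thesis by (simp add: mult.commute)
qed

text \<open>The left-hand side is the tangent at \<open>0\<close> of the convex function \<open>t \<mapsto> ip (heat \<omega> t f) f\<close>.\<close>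

lemma heat_ip_lower:
  assumes f: "f \<in> lp \<omega> 2" and "0 \<le> t"
  shows "ip f f - t * energy f \<le> ip (heat \<omega> t f) f"
proof -
  let ?\<phi> = "\<lambda>t. ip (heat \<omega> t f) f" and ?\<phi>' = "\<lambda>t. ip (heat \<omega> t (laplacian \<omega> f)) f"
  note lf = laplacian_lp2(1)[OF f]
  have convex: "?\<phi>' 0 \<le> ?\<phi>' s" if "0 \<le> s" for s
  proof (rule DERIV_nonneg_imp_nondecreasing[OF that])
    fix r
    \<comment> \<open>The second derivative at r is the squared norm of
      \<open>heat \<omega> (r / 2) (laplacian \<omega> f)\<close>, hence nonnegative.\<close>
    have "ip (heat \<omega> r (laplacian \<omega> (laplacian \<omega> f))) f
        = ip (heat \<omega> (r / 2 + r / 2) (laplacian \<omega> f)) (laplacian \<omega> f)"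
      using laplacian_selfadjoint[OF heat_lp2[OF lf] f, of r] by (simp add: laplacian_heat[OF lf])
    also have "\<dots> = ip (heat \<omega> (r / 2) (laplacian \<omega> f)) (heat \<omega> (r / 2) (laplacian \<omega> f))"
      by (rule heat_semigroup[OF lf lf, symmetric])
    also have "0 \<le> \<dots>" by (rule ip_self_nonneg)
    finally show "\<exists>y. (?\<phi>' has_real_derivative y) (at r) \<and> 0 \<le> y"
      using heat_ip_deriv[OF lf f] by blast
  qed
  have "?\<phi> 0 - 0 * ?\<phi>' 0 \<le> ?\<phi> t - t * ?\<phi>' 0"
  proof (rule DERIV_nonneg_imp_nondecreasing[OF \<open>0 \<le> t\<close>, of "\<lambda>t. ?\<phi> t - t * ?\<phi>' 0"])
    fix s :: real assume "0 \<le> s"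
    have "((\<lambda>t. ?\<phi> t - t * ?\<phi>' 0) has_real_derivative ?\<phi>' s - ?\<phi>' 0) (at s)"
      using DERIV_diff[OF heat_ip_deriv[OF f f] DERIV_cmult_Id[of "?\<phi>' 0" s UNIV]]
      by (simp only: mult.commute)
    then show "\<exists>y. ((\<lambda>t. ?\<phi> t - t * ?\<phi>' 0) has_real_derivative y) (at s) \<and> 0 \<le> y"
      using convex[OF \<open>0 \<le> s\<close>] by (intro exI[of _ "?\<phi>' s - ?\<phi>' 0"]) simp
  qed
  then show ?thesis by (simp add: heat_0 energy_eq_ip_laplacian f)
qed

section \<open>Positivity and mass of the heat flow\<close>

text \<open>The transition operator of the weighted random walk. Unlike \<Delta>, it preserves
  nonnegativity.\<close>

definition avg :: "('v \<Rightarrow> real) \<Rightarrow> 'v \<Rightarrow> real" where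
  "avg f x = (\<Sum>y\<in>nbrs \<omega> x. \<omega> x y * f y) / deg \<omega> x"

lemma laplacian_avg: "laplacian \<omega> f x = avg f x - f x"
  using deg_laplacian[of x f] deg_pos[of x] by (simp add: avg_def field_simps)

lemma avg_sum: "avg (\<lambda>x. \<Sum>k\<in>A. c k * h k x) x = (\<Sum>k\<in>A. c k * avg (h k) x)"
proof -
  have "(\<Sum>y\<in>nbrs \<omega> x. \<omega> x y * (\<Sum>k\<in>A. c k * h k y)) = (\<Sum>k\<in>A. c k * (\<Sum>y\<in>nbrs \<omega> x. \<omega> x y * h k y))"
    unfolding sum_distrib_left by (subst sum.swap) (simp add: mult_ac)
  then show ?thesis unfolding avg_def times_divide_eq_right by (simp only: sum_divide_distrib)
qed

text \<open>Binomial expansion of (avg - 1)^n. The sign exponent n + k has the parity of n - k and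
  avoids truncated subtraction.\<close>

lemma laplacian_power_avg:
  "(laplacian \<omega> ^^ n) f x = (\<Sum>k\<le>n. (- 1) ^ (n + k) * real (n choose k) * (avg ^^ k) f x)"
proof (induction n arbitrary: x)
  case (Suc n)
  let ?p = "\<lambda>k. (avg ^^ k) f x"
  let ?c = "\<lambda>n k. (- 1) ^ (n + k) * real (n choose k)"
  have "(laplacian \<omega> ^^ n) f = (\<lambda>x. \<Sum>k\<le>n. ?c n k * (avg ^^ k) f x)"
    using Suc.IH by blast
  then have "(laplacian \<omega> ^^ Suc n) f x = (\<Sum>k\<le>n. ?c n k * ?p (Suc k)) - (\<Sum>k\<le>n. ?c n k * ?p k)"
    by (simp add: laplacian_avg avg_sum)
  \<comment> \<open>The added term vanishes because \<open>n choose Suc n\<close> is 0; splitting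
    off k = 0 instead prepares Pascal's rule.\<close>
  also have "(\<Sum>k\<le>n. ?c n k * ?p k) = (\<Sum>k\<le>Suc n. ?c n k * ?p k)"
    by simp
  also have "\<dots> = ?c n 0 * ?p 0 + (\<Sum>k\<le>n. ?c n (Suc k) * ?p (Suc k))"
    by (rule sum.atMost_Suc_shift)
  also have "(\<Sum>k\<le>n. ?c n k * ?p (Suc k)) - (?c n 0 * ?p 0 + (\<Sum>k\<le>n. ?c n (Suc k) * ?p (Suc k)))
      = ?c (Suc n) 0 * ?p 0 + (\<Sum>k\<le>n. ?c (Suc n) (Suc k) * ?p (Suc k))"
    by (simp add: sum_subtractf[symmetric] algebra_simps sum.distrib[symmetric] del: funpow.simps)
  also have "\<dots> = (\<Sum>k\<le>Suc n. ?c (Suc n) k * ?p k)"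
    by (rule sum.atMost_Suc_shift[symmetric])
  finally show ?case .
qed simp

text \<open>Since \<open>avg = \<Delta> + 1\<close>, this is \<open>e\<^bsup>t\<Delta>\<^esup> = e\<^bsup>- t\<^esup> e\<^bsup>t(\<Delta> + 1)\<^esup>\<close>, which makes positivity of the heat semigroup visible.\<close>

lemma heat_avg_sums:
  assumes abs: "summable (\<lambda>k. \<bar>t ^ k / fact k * (avg ^^ k) f x\<bar>)"
  shows "(\<lambda>k. exp (- t) * (t ^ k / fact k * (avg ^^ k) f x)) sums heat \<omega> t f x"
proof -
  let ?a = "\<lambda>k. t ^ k / fact k * (avg ^^ k) f x" and ?b = "\<lambda>k. (- t) ^ k / fact k"
  have "summable (\<lambda>k. norm (?b k))"
    using exp_terms[of "\<bar>t\<bar>"] by (simp add: power_abs sums_iff)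
  with abs have "(\<lambda>n. \<Sum>i\<le>n. ?a i * ?b (n - i)) sums ((\<Sum>k. ?a k) * (\<Sum>k. ?b k))"
    by (intro Cauchy_product_sums) auto
  \<comment> \<open>The convolution of the two exponential series reproduces the binomial expansion
    of \<Delta>^n.\<close>
  moreover have "(\<Sum>i\<le>n. ?a i * ?b (n - i)) = t ^ n / fact n * (laplacian \<omega> ^^ n) f x" for n
    unfolding laplacian_power_avg sum_distrib_left
  proof (rule sum.cong)
    fix i assume "i \<in> {..n}"
    then obtain j where n: "n = i + j" by (auto simp: le_iff_add)
    have "even (i + j + i) \<longleftrightarrow> even j" by presburger
    then have "(- 1) ^ (i + j + i) = ((- 1) ^ j :: real)" by (metis neg_one_even_power neg_one_odd_power)
    then show "?a i * ?b (n - i) = t ^ n / fact n * ((- 1) ^ (n + i) * real (n choose i) * (avg ^^ i) f x)"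
      by (simp add: n binomial_fact power_add power_minus[of t])
  qed simp
  ultimately have "heat \<omega> t f x = exp (- t) * (\<Sum>k. ?a k)"
    unfolding heat_def using exp_terms[of "- t"] by (simp add: sums_iff)
  moreover have "?a sums (\<Sum>k. ?a k)"
    by (rule summable_sums[OF summable_rabs_cancel[OF abs]])
  ultimately show ?thesis by (simp only: sums_mult)
qed

text \<open>After exchanging the sums, f y is weighted by what y sends into F, at most
  \<open>deg \<omega> y\<close>. Stating mass through finite sums keeps summability out of the
  iteration.\<close>

lemma avg_mass:
  assumes nonneg: "\<And>x. 0 \<le> f x" and mass: "\<And>F. finite F \<Longrightarrow> (\<Sum>x\<in>F. deg \<omega> x * f x) \<le> M"
    and F: "finite F"
  shows "(\<Sum>x\<in>F. deg \<omega> x * avg f x) \<le> M"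
proof -
  define U where "U = (\<Union>x\<in>F. nbrs \<omega> x)"
  have U: "finite U" using F locally_finite by (simp add: U_def)
  have "(\<Sum>x\<in>F. deg \<omega> x * avg f x) = (\<Sum>x\<in>F. \<Sum>y\<in>nbrs \<omega> x. \<omega> x y * f y)"
    using deg_pos by (intro sum.cong) (auto simp: avg_def less_imp_neq[symmetric])
  also have "\<dots> \<le> (\<Sum>x\<in>F. \<Sum>y\<in>U. \<omega> x y * f y)"
    using U by (intro sum_mono sum_mono2) (auto simp: U_def weight_nonneg nonneg)
  \<comment> \<open>The factor 1 makes the inner sum an instance of
    \<open>nbrs_has_sum\<close>.\<close>
  also have "\<dots> = (\<Sum>y\<in>U. (\<Sum>x\<in>F. \<omega> y x * 1) * f y)"
    by (subst sum.swap) (simp add: sum_distrib_right weight_sym)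
  also have "\<dots> \<le> (\<Sum>y\<in>U. deg \<omega> y * f y)"
  proof (intro sum_mono mult_right_mono nonneg)
    fix y
    show "(\<Sum>x\<in>F. \<omega> y x * 1) \<le> deg \<omega> y"
      using finite_sum_le_has_sum[OF nbrs_has_sum[of y "\<lambda>_. 1"] F] by (simp add: weight_nonneg deg_def)
  qed
  also have "\<dots> \<le> M" by (rule mass[OF U])
  finally show ?thesis .
qed

lemma avg_power_mass:
  assumes "\<And>x. 0 \<le> f x" "\<And>F. finite F \<Longrightarrow> (\<Sum>x\<in>F. deg \<omega> x * f x) \<le> M"
  shows "(\<forall>x. 0 \<le> (avg ^^ k) f x) \<and> (\<forall>F. finite F \<longrightarrow> (\<Sum>x\<in>F. deg \<omega> x * (avg ^^ k) f x) \<le> M)"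
proof (induction k)
  case (Suc k)
  then have "0 \<le> avg ((avg ^^ k) f) x" for x
    unfolding avg_def[of "(avg ^^ k) f"]
    by (intro divide_nonneg_nonneg sum_nonneg mult_nonneg_nonneg weight_nonneg less_imp_le[OF deg_pos]) auto
  moreover have "(\<Sum>x\<in>F. deg \<omega> x * avg ((avg ^^ k) f) x) \<le> M" if "finite F" for F
    using Suc that by (intro avg_mass) auto
  ultimately show ?case by simp
qed (use assms in auto)

text \<open>By \<open>heat_avg_sums\<close> the heat flow is a Poisson average of the powers of
  \<open>avg\<close>: its weights are nonnegative for t \<ge> 0 and add up to 1, so both properties
  pass over.\<close>

lemma heat_mass:
  assumes nonneg: "\<And>x. 0 \<le> f x" and mass: "\<And>F. finite F \<Longrightarrow> (\<Sum>x\<in>F. deg \<omega> x * f x) \<le> M"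
    and t: "0 \<le> t"
  shows "0 \<le> heat \<omega> t f x" "finite F \<Longrightarrow> (\<Sum>x\<in>F. deg \<omega> x * heat \<omega> t f x) \<le> M"
proof -
  let ?p = "\<lambda>k x. (avg ^^ k) f x"
  have p: "0 \<le> ?p k x" "finite F \<Longrightarrow> (\<Sum>x\<in>F. deg \<omega> x * ?p k x) \<le> M" for k x F
    using avg_power_mass[of f M k] nonneg mass by blast+
  have series: "(\<lambda>k. exp (- t) * (t ^ k / fact k * ?p k x)) sums heat \<omega> t f x" for x
  proof (rule heat_avg_sums, rule summable_comparison_test')
    show "summable (\<lambda>k. t ^ k / fact k * (M / deg \<omega> x))"
      using exp_terms[THEN sums_summable] by (rule summable_mult2)
    fix k
    \<comment> \<open>The mass bound on a singleton is a pointwise bound uniform in k.\<close>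
    have "?p k x \<le> M / deg \<omega> x"
      using p(2)[of "{x}" k] deg_pos[of x] by (simp add: field_simps)
    then have "t ^ k / fact k * ?p k x \<le> t ^ k / fact k * (M / deg \<omega> x)"
      using t by (intro mult_left_mono) auto
    then show "norm \<bar>t ^ k / fact k * ?p k x\<bar> \<le> t ^ k / fact k * (M / deg \<omega> x)"
      using t p(1)[of k x] by (simp add: abs_mult)
  qed
  show "0 \<le> heat \<omega> t f x"
    using series[of x] t p(1) by (intro sums_le[OF _ sums_zero series]) auto
  assume F: "finite F"
  have "(\<lambda>k. \<Sum>x\<in>F. deg \<omega> x * (exp (- t) * (t ^ k / fact k * ?p k x))) sums (\<Sum>x\<in>F. deg \<omega> x * heat \<omega> t f x)"
    by (intro sums_sum sums_mult series)
  moreover have "(\<lambda>k. exp (- t) * (t ^ k / fact k) * M) sums (exp (- t) * exp t * M)"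
    by (intro sums_mult sums_mult2 exp_terms)
  moreover have "(\<Sum>x\<in>F. deg \<omega> x * (exp (- t) * (t ^ k / fact k * ?p k x))) \<le> exp (- t) * (t ^ k / fact k) * M" for k
  proof -
    have "(\<Sum>x\<in>F. deg \<omega> x * (exp (- t) * (t ^ k / fact k * ?p k x)))
        = exp (- t) * (t ^ k / fact k) * (\<Sum>x\<in>F. deg \<omega> x * ?p k x)"
      by (simp add: sum_distrib_left mult_ac)
    also have "\<dots> \<le> exp (- t) * (t ^ k / fact k) * M"
      using t by (intro mult_left_mono p(2) F) auto
    finally show ?thesis .
  qed
  ultimately have "(\<Sum>x\<in>F. deg \<omega> x * heat \<omega> t f x) \<le> exp (- t) * exp t * M"
    by (rule sums_le[rotated])
  then show "(\<Sum>x\<in>F. deg \<omega> x * heat \<omega> t f x) \<le> M"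
    by (simp add: exp_minus_inverse mult.commute[of "exp (- t)"])
qed

section \<open>Finitely supported functions and the two implications\<close>

lemma finite_support_lp2: "finite {x. f x \<noteq> 0} \<Longrightarrow> f \<in> lp \<omega> 2"
  unfolding lp2_iff by (intro finite_nonzero_values_imp_summable_on) simp

lemma lp_norm1_finite_support:
  assumes "finite A" "{x. f x \<noteq> 0} \<subseteq> A" "\<And>x. 0 \<le> f x"
  shows "lp_norm \<omega> 1 f = (\<Sum>x\<in>A. deg \<omega> x * f x)"
proof -
  have "(\<Sum>\<^sub>\<infinity>x. deg \<omega> x * \<bar>f x\<bar> powr 1) = (\<Sum>x\<in>A. deg \<omega> x * f x)"
    using assms by (intro infsumI has_sum_finite_neutralI[of A]) auto
  moreover have "0 \<le> (\<Sum>x\<in>A. deg \<omega> x * f x)"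
    using assms(3) by (intro sum_nonneg mult_nonneg_nonneg less_imp_le[OF deg_pos])
  ultimately show ?thesis by (simp add: lp_norm_def)
qed

lemma ip_finite_support:
  assumes "finite A" "{x. f x \<noteq> 0} \<subseteq> A"
  shows "ip g f = (\<Sum>x\<in>A. deg \<omega> x * g x * f x)"
  unfolding ip_def using assms by (intro infsumI has_sum_finite_neutralI[of A]) auto

lemma lp_norm2_powr: "lp_norm \<omega> 2 f powr (2 * p) = ip f f powr p"
proof -
  have "lp_norm \<omega> 2 f powr 2 = ip f f"
    by (simp add: lp_norm2_nonneg lp_norm2_sq[symmetric] powr_numeral)
  then show ?thesis by (simp flip: powr_powr)
qed

text \<open>Duality is carried out by hand: with u = P_t f, the square of the norm of u is
  \<langle>P_t u, f\<rangle>, and ultracontractivity bounds P_t u pointwise by the norm of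
  u.\<close>

lemma ultracontractive_imp_nash:
  assumes "0 < \<mu>" "0 \<le> c"
    and ultra: "\<And>t f. 0 < t \<Longrightarrow> f \<in> lp \<omega> 2 \<Longrightarrow>
      sup_norm (heat \<omega> t f) \<le> ereal (c * t powr (- \<mu> / 4) * lp_norm \<omega> 2 f)"
    and fin: "finite {x. f x \<noteq> 0}" and nonneg: "\<And>x. 0 \<le> f x"
  shows "lp_norm \<omega> 2 f powr (2 + 4 / \<mu>) \<le> (c\<^sup>2 + 2) powr (1 + 2 / \<mu>) * energy f * lp_norm \<omega> 1 f powr (4 / \<mu>)"
proof -
  let ?M = "lp_norm \<omega> 1 f"
  note f = finite_support_lp2[OF fin]
  have M: "?M = (\<Sum>x\<in>{x. f x \<noteq> 0}. deg \<omega> x * f x)"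
    by (rule lp_norm1_finite_support[OF fin order_refl nonneg])
  have "ip f f \<le> c\<^sup>2 * t powr (- \<mu> / 2) * ?M\<^sup>2 + 2 * t * energy f" if "0 < t" for t
  proof -
    let ?u = "heat \<omega> t f" and ?k = "c * t powr (- \<mu> / 4)"
    note u = heat_lp2[OF f, of t]
    have sup: "heat \<omega> t ?u x \<le> ?k * lp_norm \<omega> 2 ?u" for x
    proof -
      have "ereal \<bar>heat \<omega> t ?u x\<bar> \<le> sup_norm (heat \<omega> t ?u)"
        unfolding sup_norm_def by (rule SUP_upper) simp
      also have "\<dots> \<le> ereal (?k * lp_norm \<omega> 2 ?u)" by (rule ultra[OF that u])
      finally show ?thesis by simp
    qed
    have "(lp_norm \<omega> 2 ?u)\<^sup>2 = ip (heat \<omega> t ?u) f"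
      unfolding lp_norm2_sq by (rule heat_selfadjoint[OF u f, symmetric])
    also have "\<dots> = (\<Sum>x\<in>{x. f x \<noteq> 0}. deg \<omega> x * f x * heat \<omega> t ?u x)"
      using ip_finite_support[OF fin order_refl, of "heat \<omega> t ?u"] by (simp only: mult_ac)
    also have "\<dots> \<le> (\<Sum>x\<in>{x. f x \<noteq> 0}. deg \<omega> x * f x * (?k * lp_norm \<omega> 2 ?u))"
      by (intro sum_mono mult_left_mono sup mult_nonneg_nonneg nonneg less_imp_le[OF deg_pos])
    also have "\<dots> = ?M * (?k * lp_norm \<omega> 2 ?u)"
      by (simp only: M sum_distrib_right)
    finally have "lp_norm \<omega> 2 ?u * lp_norm \<omega> 2 ?u \<le> (?k * ?M) * lp_norm \<omega> 2 ?u"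
      by (simp add: power2_eq_square mult_ac)
    moreover have "0 \<le> ?k * ?M" using \<open>0 \<le> c\<close> by (simp add: lp_norm_def)
    \<comment> \<open>One factor of the norm cancels; if it is 0, the bound is the nonnegativity of
      \<open>?k * ?M\<close>.\<close>
    ultimately have "lp_norm \<omega> 2 ?u \<le> ?k * ?M"
      using lp_norm2_nonneg[of ?u] by (cases "lp_norm \<omega> 2 ?u = 0") auto
    then have "(lp_norm \<omega> 2 ?u)\<^sup>2 \<le> (?k * ?M)\<^sup>2"
      by (intro power_mono lp_norm2_nonneg)
    moreover have "(t powr (- \<mu> / 4))\<^sup>2 = t powr (- \<mu> / 2)"
      by (simp add: power2_eq_square flip: powr_add)
    \<comment> \<open>The squared norm is \<open>ip (heat \<omega> (t + t) f) f\<close>, so the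
      tangent bound is taken at time 2t.\<close>
    moreover have "ip f f - (t + t) * energy f \<le> (lp_norm \<omega> 2 ?u)\<^sup>2"
      unfolding lp_norm2_sq heat_semigroup[OF f f] using that by (intro heat_ip_lower f) simp
    ultimately show ?thesis by (simp add: power_mult_distrib)
  qed
  then have "ip f f powr (1 + 2 / \<mu>) \<le> (c\<^sup>2 + 2) powr (1 + 2 / \<mu>) * energy f * ?M powr (4 / \<mu>)"
    using assms(1) by (intro nash_balance energy_nonneg ip_self_nonneg) (auto simp: lp_norm_def)
  then show ?thesis
    using lp_norm2_powr[of f "1 + 2 / \<mu>"] by (simp add: distrib_left)
qed

text \<open>The heat flow need not preserve finite support. Nash's inequality is applied to the
  truncations of u to finite F, with M bounding their masses; norm and energy converge as F exhausts
  the vertices.\<close>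

lemma nash_lp2:
  assumes "0 < \<mu>" "0 \<le> c"
    and nash: "\<And>f. finite {x. f x \<noteq> 0} \<Longrightarrow> (\<And>x. 0 \<le> f x) \<Longrightarrow>
      lp_norm \<omega> 2 f powr (2 + 4 / \<mu>) \<le> c * energy f * lp_norm \<omega> 1 f powr (4 / \<mu>)"
    and u: "u \<in> lp \<omega> 2" and nonneg: "\<And>x. 0 \<le> u x"
    and mass: "\<And>F. finite F \<Longrightarrow> (\<Sum>x\<in>F. deg \<omega> x * u x) \<le> M"
  shows "ip u u powr (1 + 2 / \<mu>) \<le> c * energy u * M powr (4 / \<mu>)"
proof -
  let ?q = "\<lambda>F. \<Sum>x\<in>F. deg \<omega> x * u x * u x"
  let ?r = "\<lambda>F. \<Sum>(x, y)\<in>F \<times> F. \<omega> x y * u x * u y"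
  let ?F = "finite_subsets_at_top (UNIV :: 'v set)"
  have q: "(?q \<longlongrightarrow> ip u u) ?F"
    using ip_has_sum[OF u u] by (simp add: has_sum_def)
  have r: "(?r \<longlongrightarrow> pair_form u u) ?F"
    using filterlim_compose[OF pair_form_has_sum[OF u u, unfolded has_sum_def] finite_squares_exhaust] .
  have bound: "?q F powr (1 + 2 / \<mu>) \<le> c * (?q F - ?r F) * M powr (4 / \<mu>)" if F: "finite F" for F
  proof -
    let ?v = "\<lambda>x. if x \<in> F then u x else 0"
    have v: "finite {x. ?v x \<noteq> 0}" "{x. ?v x \<noteq> 0} \<subseteq> F" "\<And>x. 0 \<le> ?v x"
      using F nonneg by (auto intro: finite_subset)
    have q': "ip ?v ?v = ?q F"
      using ip_finite_support[OF F v(2), of ?v] by simp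
    have "pair_form ?v ?v = ?r F"
      unfolding pair_form_def using F
      by (intro infsumI has_sum_finite_neutralI[of "F \<times> F"] sum.cong) (auto split: if_splits)
    \<comment> \<open>\<open>?q F\<close> carries full degrees, so edges leaving F are accounted
      for.\<close>
    then have "energy ?v = ?q F - ?r F"
      by (simp only: energy_eq finite_support_lp2[OF v(1)] q')
    moreover have "lp_norm \<omega> 1 ?v = (\<Sum>x\<in>F. deg \<omega> x * u x)"
      unfolding lp_norm1_finite_support[OF F v(2,3)] by simp
    then have "lp_norm \<omega> 1 ?v powr (4 / \<mu>) \<le> M powr (4 / \<mu>)"
      using mass[OF F] \<open>0 < \<mu>\<close> by (intro powr_mono2) (auto simp: lp_norm_def)
    then have "c * energy ?v * lp_norm \<omega> 1 ?v powr (4 / \<mu>) \<le> c * energy ?v * M powr (4 / \<mu>)"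
      using \<open>0 \<le> c\<close> by (intro mult_left_mono mult_nonneg_nonneg energy_nonneg)
    moreover have "?q F powr (1 + 2 / \<mu>) = lp_norm \<omega> 2 ?v powr (2 + 4 / \<mu>)"
      using lp_norm2_powr[of ?v "1 + 2 / \<mu>"] by (simp add: distrib_left q')
    ultimately show ?thesis using nash[OF v(1,3)] by simp
  qed
  \<comment> \<open>The limit may be 0, so convergence of the powers uses the positive exponent and
    the nonnegative bases.\<close>
  have "((\<lambda>F. ?q F powr (1 + 2 / \<mu>)) \<longlongrightarrow> ip u u powr (1 + 2 / \<mu>)) ?F"
    using \<open>0 < \<mu>\<close> nonneg
    by (intro tendsto_powr' q tendsto_const)
      (auto intro!: always_eventually sum_nonneg mult_nonneg_nonneg less_imp_le[OF deg_pos] disjI2 add_pos_pos)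
  moreover have "((\<lambda>F. c * (?q F - ?r F) * M powr (4 / \<mu>)) \<longlongrightarrow> c * (ip u u - pair_form u u) * M powr (4 / \<mu>)) ?F"
    by (intro tendsto_intros q r)
  moreover have "\<forall>\<^sub>F F in ?F. ?q F powr (1 + 2 / \<mu>) \<le> c * (?q F - ?r F) * M powr (4 / \<mu>)"
    using eventually_finite_subsets_at_top_weakI[of UNIV] bound by blast
  ultimately show ?thesis
    unfolding energy_eq[OF u] by (intro tendsto_le[OF finite_subsets_at_top_neq_bot])
qed

lemma nash_imp_ultracontractive:
  assumes "0 < \<mu>" "0 < c"
    and nash: "\<And>f. finite {x. f x \<noteq> 0} \<Longrightarrow> (\<And>x. 0 \<le> f x) \<Longrightarrow>
      lp_norm \<omega> 2 f powr (2 + 4 / \<mu>) \<le> c * energy f * lp_norm \<omega> 1 f powr (4 / \<mu>)"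
    and "0 < t" and g: "g \<in> lp \<omega> 2"
  shows "sup_norm (heat \<omega> t g) \<le> ereal ((4 / (\<mu> * c)) powr (- \<mu> / 4) * t powr (- \<mu> / 4) * lp_norm \<omega> 2 g)"
  unfolding sup_norm_def
proof (rule SUP_least)
  fix z
  \<comment> \<open>The unnormalised indicator of z: its mass is \<open>deg \<omega> z\<close>, and
    pairing with it yields \<open>deg \<omega> z\<close> times the value at z.\<close>
  define d :: "'v \<Rightarrow> real" where "d = (\<lambda>x. if x = z then 1 else 0)"
  let ?M = "deg \<omega> z" and ?u = "\<lambda>s. heat \<omega> s d"
  have fin: "finite {x. d x \<noteq> 0}" and supp: "{x. d x \<noteq> 0} \<subseteq> {z}" and nonneg: "\<And>x. 0 \<le> d x"
    by (auto simp: d_def)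
  note d = finite_support_lp2[OF fin]
  have mass: "(\<Sum>x\<in>F. deg \<omega> x * d x) \<le> ?M" if "finite F" for F
    using that less_imp_le[OF deg_pos[of z]] by (simp add: d_def if_distrib[of "(*) _"] cong: if_cong)
  \<comment> \<open>Nash's inequality solved for the energy, with the factor 2 from the derivative
    of the squared norm.\<close>
  define K where "K = 2 / (c * ?M powr (4 / \<mu>))"
  have M: "0 < ?M" by (rule deg_pos)
  have "ip (?u t) (?u t) \<le> (K / (\<mu> / 2) * t) powr (- (\<mu> / 2))"
  proof (rule nash_decay[OF _ _ \<open>0 < t\<close> ip_self_nonneg heat_norm_deriv[OF d]])
    show "0 < \<mu> / 2" using assms by simp
    show "0 < K" using assms M by (simp add: K_def)
    fix s :: real assume s: "0 \<le> s"
    have "ip (?u s) (?u s) powr (1 + 2 / \<mu>) \<le> c * energy (?u s) * ?M powr (4 / \<mu>)"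
      using assms heat_mass[OF nonneg mass s]
      by (intro nash_lp2 nash heat_lp2 d) auto
    then show "- 2 * energy (?u s) \<le> - K * ip (?u s) (?u s) powr (1 + 1 / (\<mu> / 2))"
      using \<open>0 < c\<close> M by (simp add: K_def field_simps)
  qed
  \<comment> \<open>\<open>K / (\<mu> / 2)\<close> contains \<open>?M powr (- 4 / \<mu>)\<close>,
    whose power - \<mu>/2 is \<open>?M\<^sup>2\<close>; the resulting factor \<open>?M\<close> in
    the norm cancels against \<open>deg \<omega> z\<close> at the end.\<close>
  also have "\<dots> = ((4 / (\<mu> * c)) powr (- \<mu> / 4) * t powr (- \<mu> / 4) * ?M)\<^sup>2"
  proof -
    have "K / (\<mu> / 2) * t = 4 / (\<mu> * c) * t * ?M powr (- 4 / \<mu>)"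
      using assms M by (simp add: K_def powr_minus divide_simps)
    moreover have "(?M powr (- 4 / \<mu>)) powr (- (\<mu> / 2)) = ?M\<^sup>2"
      using assms M by (simp add: powr_powr)
    moreover have "(y powr (- \<mu> / 4))\<^sup>2 = y powr (- (\<mu> / 2))" for y :: real
      by (simp add: power2_eq_square flip: powr_add)
    ultimately show ?thesis
      using assms M by (simp only: powr_mult power_mult_distrib)
  qed
  finally have "(lp_norm \<omega> 2 (?u t))\<^sup>2 \<le> ((4 / (\<mu> * c)) powr (- \<mu> / 4) * t powr (- \<mu> / 4) * ?M)\<^sup>2"
    by (simp only: lp_norm2_sq)
  then have norm: "lp_norm \<omega> 2 (?u t) \<le> (4 / (\<mu> * c)) powr (- \<mu> / 4) * t powr (- \<mu> / 4) * ?M"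
    by (rule power2_le_imp_le) (use M in simp)
  have "?M * heat \<omega> t g z = ip (heat \<omega> t g) d"
    using ip_finite_support[OF _ supp, of "heat \<omega> t g"] by (simp add: d_def)
  also have "\<dots> = ip g (?u t)" by (rule heat_selfadjoint[OF g d])
  finally have "?M * \<bar>heat \<omega> t g z\<bar> = \<bar>ip g (?u t)\<bar>"
    using M by (metis abs_mult abs_of_pos)
  also have "\<dots> \<le> lp_norm \<omega> 2 g * lp_norm \<omega> 2 (?u t)"
    by (rule ip_Cauchy_Schwarz[OF g heat_lp2[OF d]])
  also have "\<dots> \<le> lp_norm \<omega> 2 g * ((4 / (\<mu> * c)) powr (- \<mu> / 4) * t powr (- \<mu> / 4) * ?M)"
    by (intro mult_left_mono norm lp_norm2_nonneg)
  also have "\<dots> = ?M * ((4 / (\<mu> * c)) powr (- \<mu> / 4) * t powr (- \<mu> / 4) * lp_norm \<omega> 2 g)"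
    by (simp only: mult_ac)
  finally show "ereal \<bar>heat \<omega> t g z\<bar> \<le> ereal ((4 / (\<mu> * c)) powr (- \<mu> / 4) * t powr (- \<mu> / 4) * lp_norm \<omega> 2 g)"
    using M by simp
qed

end

theorem theorem4p1:
  fixes \<omega> :: "'v \<Rightarrow> 'v \<Rightarrow> real" and \<mu> :: real
  assumes "weighted_graph \<omega>" and "0 < \<mu>"
  shows "(\<exists>c1>0. \<forall>t>0. \<forall>f\<in>lp \<omega> 2.
            sup_norm (heat \<omega> t f) \<le> ereal (c1 * t powr (- \<mu> / 4) * lp_norm \<omega> 2 f))
     \<longleftrightarrow> (\<exists>c2>0. \<forall>f. finite {x. f x \<noteq> 0} \<and> (\<forall>x. 0 \<le> f x) \<longrightarrow>
            lp_norm \<omega> 2 f powr (2 + 4 / \<mu>)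
              \<le> c2 * graph_sum \<omega> (grad_form \<omega> f) * lp_norm \<omega> 1 f powr (4 / \<mu>))"
proof
  interpret weighted_graph \<omega> by fact
  show "\<exists>c2>0. \<forall>f. finite {x. f x \<noteq> 0} \<and> (\<forall>x. 0 \<le> f x) \<longrightarrow>
      lp_norm \<omega> 2 f powr (2 + 4 / \<mu>)
        \<le> c2 * graph_sum \<omega> (grad_form \<omega> f) * lp_norm \<omega> 1 f powr (4 / \<mu>)"
    if ultra: "\<exists>c1>0. \<forall>t>0. \<forall>f\<in>lp \<omega> 2.
      sup_norm (heat \<omega> t f) \<le> ereal (c1 * t powr (- \<mu> / 4) * lp_norm \<omega> 2 f)"
  proof -
    obtain c where "0 < c" "\<And>t f. 0 < t \<Longrightarrow> f \<in> lp \<omega> 2 \<Longrightarrow>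
        sup_norm (heat \<omega> t f) \<le> ereal (c * t powr (- \<mu> / 4) * lp_norm \<omega> 2 f)"
      using ultra by blast
    note nash = ultracontractive_imp_nash[OF \<open>0 < \<mu>\<close> less_imp_le[OF this(1)] this(2)]
    have "0 < (c\<^sup>2 + 2) powr (1 + 2 / \<mu>)"
      using zero_le_power2[of c] by (simp add: add_nonneg_eq_0_iff)
    then show ?thesis using nash by blast
  qed
  show "\<exists>c1>0. \<forall>t>0. \<forall>f\<in>lp \<omega> 2.
      sup_norm (heat \<omega> t f) \<le> ereal (c1 * t powr (- \<mu> / 4) * lp_norm \<omega> 2 f)"
    if nash: "\<exists>c2>0. \<forall>f. finite {x. f x \<noteq> 0} \<and> (\<forall>x. 0 \<le> f x) \<longrightarrow>
      lp_norm \<omega> 2 f powr (2 + 4 / \<mu>)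
        \<le> c2 * graph_sum \<omega> (grad_form \<omega> f) * lp_norm \<omega> 1 f powr (4 / \<mu>)"
  proof -
    obtain c where "0 < c" "\<And>f. finite {x. f x \<noteq> 0} \<Longrightarrow> (\<And>x. 0 \<le> f x) \<Longrightarrow>
        lp_norm \<omega> 2 f powr (2 + 4 / \<mu>)
          \<le> c * graph_sum \<omega> (grad_form \<omega> f) * lp_norm \<omega> 1 f powr (4 / \<mu>)"
      using nash by blast
    note ultra = nash_imp_ultracontractive[OF \<open>0 < \<mu>\<close> this]
    have "0 < (4 / (\<mu> * c)) powr (- \<mu> / 4)"
      using \<open>0 < \<mu>\<close> \<open>0 < c\<close> by simp
    then show ?thesis using ultra by blast
  qed
qed

end
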